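(* Let $\vec{p},\vec{q}\in[1,\infty]^{n}$ and $\vec{\alpha}\in\mathbb{R}^n$. Then a measurable function $f$ on $\mathbb{R}^n$ belongs to the associate space $[\dot{E}^{\vec{\alpha},\vec{p}}_{\vec{q}}(\mathbb{R}^n)]'$ if and only if $f\in\dot{E}^{-\vec{\alpha},\vec{p}'}_{\vec{q}'}(\mathbb{R}^n)$. Moreover, $$\|f\|_{[\dot{E}^{\vec{\alpha},\vec{p}}_{\vec{q}}(\mathbb{R}^n)]'}=\|f\|_{\dot{E}^{-\vec{\alpha},\vec{p}'}_{\vec{q}'}(\mathbb{R}^n)}.$$
   Context: $\mathscr{M}(\mathbb{R}^n)$ is the set of all measurable functions on $\mathbb{R}^n$. For $k\in\mathbb{Z}$ let $R_k:=(-2^{k},2^{k})\setminus(-2^{k-1},2^{k-1})\subset\mathbb{R}$. For $p,q\in(0,\infty]$, $\alpha\in\mathbb{R}$, and measurable $h$ on $\mathbb{R}$, let $\|h\|_{\dot{K}^{\alpha,p}_{q}(\mathbb{R})}:=[\sum_{k\in\mathbb{Z}}2^{kp\alpha}\|h\mathbf{1}_{R_k}\|_{L^q(\mathbb{R})}^p]^{1/p}$, with the usual modifications when $p=\infty$ or $q=\infty$. For $\vec{p}=(p_1,\ldots,p_n),\vec{q}=(q_1,\ldots,q_n)\in(0,\infty]^n$ and $\vec{\alpha}=(\alpha_1,\ldots,\alpha_n)\in\mathbb{R}^n$, the mixed-norm Herz space $\dot{E}^{\vec{\alpha},\vec{p}}_{\vec{q}}(\mathbb{R}^n)$ is the set of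 all $f\in\mathscr{M}(\mathbb{R}^n)$ such that $$\|f\|_{\dot{E}^{\vec{\alpha},\vec{p}}_{\vec{q}}(\mathbb{R}^n)}:=\Big\|\cdots\|f\|_{\dot{K}^{\alpha_1,p_1}_{q_1}(\mathbb{R})}\cdots\Big\|_{\dot{K}^{\alpha_n,p_n}_{q_n}(\mathbb{R})}<\infty,$$ i.e. the norm obtained by taking successively the $\dot{K}^{\alpha_1,p_1}_{q_1}(\mathbb{R})$-norm in $x_1$, ..., and the $\dot{K}^{\alpha_n,p_n}_{q_n}(\mathbb{R})$-norm in $x_n$. For $\vec{p}\in[1,\infty]^n$, $\vec{p}'=(p_1',\ldots,p_n')$ with $1/p_i+1/p_i'=1$. The associate space (Köthe dual) is $[\dot{E}^{\vec{\alpha},\vec{p}}_{\vec{q}}(\mathbb{R}^n)]':=\{f\in\mathscr{M}(\mathbb{R}^n):\|f\|_{[\dot{E}^{\vec{\alpha},\vec{p}}_{\vec{q}}(\mathbb{R}^n)]'}<\infty\}$, where $\|f\|_{[\dot{E}^{\vec{\alpha},\vec{p}}_{\vec{q}}(\mathbb{R}^n)]'}:=\sup\{\|fg\|_{L^1(\mathbb{R}^n)}:\ g\in\dot{E}^{\vec{\alpha},\vec{p}}_{\vec{q}}(\mathbb{R}^n),\ \|g\|_{\dot{E}^{\vec{\alpha},\vec{p}}_{\vec{q}}(\mathbb{R}^n)}=1\}$. *)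

theory Defs
  imports "HOL-Probability.Essential_Supremum"
begin

text \<open>
  Exponents in $(0,\infty]$ and all (quasi-)norms are elements of \<^typ>\<open>ennreal\<close>, where
  \<open>1 / \<infinity> = 0\<close>, \<open>1 / 0 = \<infinity>\<close> and \<open>0 * \<infinity> = 0\<close>; a norm is \<open>\<infinity>\<close> exactly when the function is
  not in the space. A coordinate of $\mathbb{R}^n$ is an index in \<open>{1..n}\<close>, and values of an exponent
  vector outside \<open>{1..n}\<close> are never used.
\<close>

text \<open>
  Powers with \<open>r > 0\<close> only; the restriction matters at \<open>x = \<infinity>\<close>.
\<close>
definition enn_powr :: "ennreal \<Rightarrow> real \<Rightarrow> ennreal" where
  "enn_powr x r = (if x = \<infinity> then \<infinity> else ennreal (enn2real x powr r))"

definition Lq_norm :: "ennreal \<Rightarrow> (real \<Rightarrow> ennreal) \<Rightarrow> ennreal" where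
  "Lq_norm q h =
     (if q = \<infinity> then esssup lebesgue h
      else enn_powr (\<integral>\<^sup>+t. enn_powr (h t) (enn2real q) \<partial>lebesgue) (1 / enn2real q))"

definition dyadic_shell :: "int \<Rightarrow> real set" where
  "dyadic_shell k = {- (2 powr real_of_int k) <..< 2 powr real_of_int k} - {- (2 powr real_of_int (k - 1)) <..< 2 powr real_of_int (k - 1)}"

text \<open>
  The Herz norm of a function on $\mathbb{R}$ with modulus \<open>h\<close>. It is defined on \<open>[0,\<infinity>]\<close>-valued
  functions because the inner norms of the mixed norm may be infinite at some points.
\<close>
definition herz_norm :: "real \<Rightarrow> ennreal \<Rightarrow> ennreal \<Rightarrow> (real \<Rightarrow> ennreal) \<Rightarrow> ennreal" where
  "herz_norm \<alpha> p q h =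
     (if p = \<infinity> then (SUP k::int. ennreal (2 powr (real_of_int k * \<alpha>)) * Lq_norm q (\<lambda>t. h t * indicator (dyadic_shell k) t))
      else enn_powr
        (\<Sum>\<^sub>\<infinity>k::int. ennreal (2 powr (real_of_int k * enn2real p * \<alpha>))
            * enn_powr (Lq_norm q (\<lambda>t. h t * indicator (dyadic_shell k) t)) (enn2real p))
        (1 / enn2real p))"

text \<open>
  $\mathbb{R}^n$ with Lebesgue measure. Points are functions on \<open>{1..n}\<close>, extended by \<open>undefined\<close>.
\<close>
definition lebesgue_n :: "nat \<Rightarrow> (nat \<Rightarrow> real) measure" where
  "lebesgue_n n = completion (\<Pi>\<^sub>M i\<in>{1..n}. lborel)"

text \<open>
  \<open>herz_iter \<alpha> p q k F x\<close> takes the norms in $x_1$, then $x_2$, up to $x_k$; the result depends only on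
  the coordinates of \<open>x\<close> other than \<open>1, \<dots>, k\<close>.
\<close>
primrec herz_iter :: "(nat \<Rightarrow> real) \<Rightarrow> (nat \<Rightarrow> ennreal) \<Rightarrow> (nat \<Rightarrow> ennreal) \<Rightarrow>
    nat \<Rightarrow> ((nat \<Rightarrow> real) \<Rightarrow> ennreal) \<Rightarrow> (nat \<Rightarrow> real) \<Rightarrow> ennreal" where
  "herz_iter \<alpha> p q 0 F = F"
| "herz_iter \<alpha> p q (Suc k) F =
     (\<lambda>x. herz_norm (\<alpha> (Suc k)) (p (Suc k)) (q (Suc k)) (\<lambda>t. herz_iter \<alpha> p q k F (x(Suc k := t))))"

text \<open>
  After \<open>n\<close> steps no free coordinate is left. The base point \<open>\<lambda>_. undefined\<close> ensures that \<open>f\<close> is only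
  evaluated at points of \<open>space (lebesgue_n n)\<close>.
\<close>
definition mixed_herz_norm :: "nat \<Rightarrow> (nat \<Rightarrow> real) \<Rightarrow> (nat \<Rightarrow> ennreal) \<Rightarrow> (nat \<Rightarrow> ennreal) \<Rightarrow>
    ((nat \<Rightarrow> real) \<Rightarrow> 'a::real_normed_field) \<Rightarrow> ennreal" where
  "mixed_herz_norm n \<alpha> p q f = herz_iter \<alpha> p q n (\<lambda>x. ennreal (norm (f x))) (\<lambda>_. undefined)"

definition mixed_herz_space :: "nat \<Rightarrow> (nat \<Rightarrow> real) \<Rightarrow> (nat \<Rightarrow> ennreal) \<Rightarrow> (nat \<Rightarrow> ennreal) \<Rightarrow>
    ((nat \<Rightarrow> real) \<Rightarrow> 'a::real_normed_field) set" where
  "mixed_herz_space n \<alpha> p q = {f \<in> borel_measurable (lebesgue_n n). mixed_herz_norm n \<alpha> p q f < \<infinity>}"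

definition assoc_norm :: "nat \<Rightarrow> (nat \<Rightarrow> real) \<Rightarrow> (nat \<Rightarrow> ennreal) \<Rightarrow> (nat \<Rightarrow> ennreal) \<Rightarrow>
    ((nat \<Rightarrow> real) \<Rightarrow> 'a::real_normed_field) \<Rightarrow> ennreal" where
  "assoc_norm n \<alpha> p q f =
     (SUP g \<in> {g \<in> mixed_herz_space n \<alpha> p q. mixed_herz_norm n \<alpha> p q g = 1}.
        \<integral>\<^sup>+x. ennreal (norm (f x * g x)) \<partial>lebesgue_n n)"

definition assoc_space :: "nat \<Rightarrow> (nat \<Rightarrow> real) \<Rightarrow> (nat \<Rightarrow> ennreal) \<Rightarrow> (nat \<Rightarrow> ennreal) \<Rightarrow>
    ((nat \<Rightarrow> real) \<Rightarrow> 'a::real_normed_field) set" where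
  "assoc_space n \<alpha> p q = {f \<in> borel_measurable (lebesgue_n n). assoc_norm n \<alpha> p q f < \<infinity>}"

end

theory Submission
  imports Defs
begin

text \<open>
  The one-dimensional Herz norm is an \<open>\<ell>\<^sup>p\<close> norm of weighted \<open>L\<^sup>q\<close> norms over the dyadic shells, so the
  mixed-norm Herz space is built from Lebesgue norms alone, and the duality of \<open>L\<^sup>p\<close> and \<open>L\<^bsup>p'\<^esup>\<close> is
  carried through the construction, first from the shells to the line and then from one coordinate to
  the next. All functions take values in \<open>[0,\<infinity>]\<close>.

  The estimate of the associate norm from above is Hoelder's inequality. It holds for the Lebesgue norms
  (\<open>Lp_norm_Hoelder\<close>), hence for the Herz norms of the line, where the opposite weights cancel
  (\<open>herz_norm_Hoelder\<close>), and hence by induction on the number of coordinates for the mixed norms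
  (\<open>herz_iter_Hoelder\<close>).

  For the estimate from below one needs, for each \<open>a\<close> less than the norm of \<open>f\<close>, a function \<open>g\<close> in the unit
  ball whose pairing with \<open>\<bar>f\<bar>\<close> exceeds \<open>a\<close> (\<open>mixed_herz_norming_function\<close>). In a single variable it is
  the extremal function of Hoelder's inequality, or for the exponent pair \<open>(1, \<infinity>)\<close> a function that
  concentrates where \<open>f\<close> is nearly maximal. These functions are given explicitly and thus depend
  measurably on parameters (\<open>Lp_norm_near_extremal\<close>, \<open>herz_norm_near_extremal\<close>); the function of \<open>n\<close>
  variables is a product of \<open>n\<close> of them, where the factor for the coordinate \<open>k\<close> is chosen for the norm of \<open>f\<close>
  in the first \<open>k - 1\<close> coordinates and has the later coordinates as parameters
  (\<open>herz_iter_near_extremal\<close>). The construction requires finite inner norms; the Fatou property of all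
  the norms involved allows \<open>f\<close> to be truncated.

  All this is done for Borel functions, all of whose sections are measurable. A Lebesgue measurable
  function agrees almost everywhere with a Borel function, and the mixed norm does not
  distinguish the two (\<open>herz_iter_full_cong_AE\<close>), although some sections of the former may fail to be
  measurable.
\<close>

section \<open>Powers on \<open>[0,\<infinity>]\<close>\<close>

lemma enn_powr_ennreal: "0 \<le> a \<Longrightarrow> enn_powr (ennreal a) r = ennreal (a powr r)"
  by (simp add: enn_powr_def)

lemma enn_powr_top [simp]: "enn_powr \<infinity> r = \<infinity>" "enn_powr top r = top"
  by (simp_all add: enn_powr_def)

lemma enn_powr_0 [simp]: "enn_powr 0 r = 0"
  by (simp add: enn_powr_def)

lemma enn_powr_1 [simp]: "enn_powr 1 r = 1"
  by (simp add: enn_powr_def)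

lemma enn_powr_one [simp]: "enn_powr x 1 = x"
  by (cases x) (auto simp: enn_powr_def)

lemma enn_powr_powr: "enn_powr (enn_powr x r) s = enn_powr x (r * s)"
  by (cases x) (auto simp: enn_powr_def powr_powr)

lemma enn_powr_mult:
  assumes "c < \<infinity>" "0 < r"
  shows "enn_powr (c * x) r = enn_powr c r * enn_powr x r"
proof -
  obtain a where a: "0 \<le> a" "c = ennreal a" using assms(1) by (cases c) auto
  show ?thesis
  proof (cases x)
    case (real b)
    then show ?thesis using a
      by (simp add: enn_powr_ennreal powr_mult flip: ennreal_mult)
  next
    case top
    show ?thesis
    proof (cases "a = 0")
      case False
      then show ?thesis using a assms top
        by (simp add: enn_powr_ennreal ennreal_mult_top)
    qed (use a top in simp)
  qed
qed

lemma enn_powr_mono: "x \<le> y \<Longrightarrow> 0 < r \<Longrightarrow> enn_powr x r \<le> enn_powr y r"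
  by (cases x; cases y) (auto simp: enn_powr_def powr_mono2 top_unique)

lemma enn_powr_eq_0_iff [simp]: "enn_powr x r = 0 \<longleftrightarrow> x = 0"
  by (cases x) (auto simp: enn_powr_def)

lemma enn_powr_eq_top_iff [simp]: "enn_powr x r = top \<longleftrightarrow> x = top"
  by (cases x) (auto simp: enn_powr_def)

lemma enn_powr_less_top_iff [simp]: "enn_powr x r < top \<longleftrightarrow> x < top"
  by (simp add: less_top[symmetric])

lemma enn_powr_le_1_iff: "0 < r \<Longrightarrow> enn_powr x r \<le> 1 \<longleftrightarrow> x \<le> 1"
  using enn_powr_mono[of x 1 r] enn_powr_mono[of "enn_powr x r" 1 "1/r"]
  by (auto simp: enn_powr_powr)

lemma enn_powr_minus_1_mult: "1 \<le> s \<Longrightarrow> x * enn_powr x (s - 1) = enn_powr x s"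
proof (cases x)
  case (real a)
  assume "1 \<le> s"
  have "a * a powr (s - 1) = a powr s"
    using real by (cases "a = 0") (auto simp: powr_diff)
  then show ?thesis using real by (simp add: enn_powr_ennreal flip: ennreal_mult)
qed auto

lemma borel_measurable_enn_powr [measurable (raw)]:
  assumes [measurable]: "f \<in> borel_measurable M"
  shows "(\<lambda>x. enn_powr (f x) r) \<in> borel_measurable M"
  unfolding enn_powr_def by measurable

text \<open>
  For \<open>r > 0\<close> the power is an order isomorphism of \<open>[0,\<infinity>]\<close> with inverse the power \<open>1 / r\<close>, so it
  commutes with suprema.
\<close>
lemma enn_powr_SUP:
  assumes r: "0 < r" and ne: "I \<noteq> {}"
  shows "enn_powr (SUP i\<in>I. f i) r = (SUP i\<in>I. enn_powr (f i) r)"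
proof (rule antisym)
  let ?u = "SUP i\<in>I. enn_powr (f i) r"
  have "f i \<le> enn_powr ?u (1 / r)" if "i \<in> I" for i
  proof -
    have "enn_powr (enn_powr (f i) r) (1 / r) \<le> enn_powr ?u (1 / r)"
      using r that by (intro enn_powr_mono SUP_upper) auto
    then show ?thesis using r by (simp add: enn_powr_powr)
  qed
  then have "(SUP i\<in>I. f i) \<le> enn_powr ?u (1 / r)" by (rule SUP_least)
  then have "enn_powr (SUP i\<in>I. f i) r \<le> enn_powr (enn_powr ?u (1 / r)) r"
    using r by (rule enn_powr_mono)
  then show "enn_powr (SUP i\<in>I. f i) r \<le> ?u" using r by (simp add: enn_powr_powr)
  show "?u \<le> enn_powr (SUP i\<in>I. f i) r"
    using r by (intro SUP_least enn_powr_mono SUP_upper) auto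
qed

lemma enn_powr_Young:
  assumes "1 < r" "1 < s" "1 / r + 1 / s = 1"
  shows "x * y \<le> ennreal (1 / r) * enn_powr x r + ennreal (1 / s) * enn_powr y s"
proof -
  consider "x = \<infinity> \<or> y = \<infinity>" | a b where "0 \<le> a" "x = ennreal a" "0 \<le> b" "y = ennreal b"
    by (cases x; cases y) auto
  then show ?thesis
  proof cases
    case 1
    then have "ennreal (1 / r) * enn_powr x r + ennreal (1 / s) * enn_powr y s = \<infinity>"
      using assms by (auto simp: ennreal_mult_top)
    then show ?thesis by (metis infinity_ennreal_def top_greatest)
  next
    case 2
    then show ?thesis using Youngs_inequality[OF assms, of a b] assms
      by (simp add: enn_powr_ennreal ennreal_leI flip: ennreal_mult ennreal_plus)
  qed
qed

section \<open>Conjugate exponents\<close>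

definition conjugate_exponents :: "ennreal \<Rightarrow> ennreal \<Rightarrow> bool" where
  "conjugate_exponents p q \<longleftrightarrow> 1 \<le> p \<and> 1 / p + 1 / q = 1"

lemma conjugate_exponents_cases [consumes 1, case_names one infinity real]:
  assumes "conjugate_exponents p q"
  obtains "p = 1" "q = \<infinity>" | "p = \<infinity>" "q = 1"
    | r s where "1 < r" "1 < s" "1 / r + 1 / s = 1" "p = ennreal r" "q = ennreal s"
proof -
  have p1: "1 \<le> p" and eq: "1 / p + 1 / q = 1"
    using assms by (auto simp: conjugate_exponents_def)
  have qn0: "q \<noteq> 0"
  proof
    assume "q = 0"
    then have "1 / q = \<infinity>" by (simp add: divide_ennreal_def)
    with eq show False by simp
  qed
  show ?thesis
  proof (cases p)
    case top
    then have "1 / q = 1" using eq by simp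
    then have "q = 1" using qn0
      by (cases q) (auto simp: divide_ennreal simp flip: ennreal_1)
    then show ?thesis using that(2) top by simp
  next
    case (real r)
    have r1: "1 \<le> r" using p1 real by (simp add: flip: ennreal_1)
    have ip: "1 / p = ennreal (1 / r)"
      using real r1 by (simp add: divide_ennreal flip: ennreal_1)
    show ?thesis
    proof (cases q)
      case top
      then have "ennreal (1 / r) = 1" using ip eq by simp
      then have "r = 1" using r1 by (simp add: flip: ennreal_1)
      then show ?thesis using that(1) top real by simp
    next
      case (real s)
      have s0: "0 < s" using real qn0 by (cases "s = 0") auto
      have "1 / q = ennreal (1 / s)"
        using real s0 by (simp add: divide_ennreal flip: ennreal_1)
      then have "ennreal (1 / r + 1 / s) = 1" using ip eq r1 s0 by (subst ennreal_plus) auto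
      then have e: "1 / r + 1 / s = 1" by (simp only: ennreal_eq_1)
      have "0 < 1 / r" "0 < 1 / s" using r1 s0 by auto
      then have "1 / r < 1" "1 / s < 1" using e by linarith+
      then have "1 < r" "1 < s" using r1 s0 by (auto simp: divide_less_eq)
      then show ?thesis using that(3) e real \<open>p = ennreal r\<close> by blast
    qed
  qed
qed

lemma conjugate_exponents_sym: "conjugate_exponents p q \<Longrightarrow> conjugate_exponents q p"
proof -
  assume "conjugate_exponents p q"
  moreover from this have "1 \<le> q"
    by (cases rule: conjugate_exponents_cases) (simp_all flip: ennreal_1)
  ultimately show ?thesis by (simp add: conjugate_exponents_def add.commute)
qed

lemma conjugate_exponents_ge_1: "conjugate_exponents p q \<Longrightarrow> 1 \<le> p" "conjugate_exponents p q \<Longrightarrow> 1 \<le> q"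
  by (simp add: conjugate_exponents_def) (drule conjugate_exponents_sym, simp add: conjugate_exponents_def)

section \<open>Lebesgue norms of \<open>[0,\<infinity>]\<close>-valued functions\<close>

definition Lp_norm :: "'a measure \<Rightarrow> ennreal \<Rightarrow> ('a \<Rightarrow> ennreal) \<Rightarrow> ennreal" where
  "Lp_norm M p h = (if p = \<infinity> then esssup M h
     else enn_powr (\<integral>\<^sup>+t. enn_powr (h t) (enn2real p) \<partial>M) (1 / enn2real p))"

lemma Lq_norm_eq_Lp_norm: "Lq_norm = Lp_norm lebesgue"
  by (intro ext) (simp add: Lq_norm_def Lp_norm_def)

lemma Lp_norm_infinity: "Lp_norm M \<infinity> h = esssup M h" "Lp_norm M top h = esssup M h"
  by (simp_all add: Lp_norm_def)

lemma Lp_norm_real: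
  "0 \<le> r \<Longrightarrow> Lp_norm M (ennreal r) h = enn_powr (\<integral>\<^sup>+t. enn_powr (h t) r \<partial>M) (1 / r)"
  by (simp add: Lp_norm_def)

lemma Lp_norm_one: "Lp_norm M 1 h = (\<integral>\<^sup>+t. h t \<partial>M)"
  by (simp add: Lp_norm_def)

lemma exponent_cases [consumes 1, case_names infinity real]:
  assumes "1 \<le> p"
  obtains "p = \<infinity>" | r where "1 \<le> r" "p = ennreal r"
proof (cases p)
  case (real r)
  with assms have "1 \<le> r" by (simp flip: ennreal_1)
  then show ?thesis using that(2) real by blast
qed (use that in auto)

lemma Lp_norm_mono_AE:
  assumes "1 \<le> p" "g \<in> borel_measurable M" "AE t in M. g t \<le> h t"
  shows "Lp_norm M p g \<le> Lp_norm M p h"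
  using assms(1)
proof (cases p rule: exponent_cases)
  case infinity
  then show ?thesis using assms by (simp add: Lp_norm_def esssup_AE_mono)
next
  case (real r)
  have "(\<integral>\<^sup>+t. enn_powr (g t) r \<partial>M) \<le> (\<integral>\<^sup>+t. enn_powr (h t) r \<partial>M)"
    using assms(3) real(1) by (intro nn_integral_mono_AE) (auto elim!: eventually_mono intro!: enn_powr_mono)
  then show ?thesis using real by (simp add: Lp_norm_real enn_powr_mono)
qed

text \<open>
  This inequality is half of homogeneity; applied to the reciprocal scalar it also gives the other half.
\<close>
lemma Lp_norm_cmult_le:
  assumes "1 \<le> p" and [measurable]: "h \<in> borel_measurable M" and c: "c < \<infinity>"
  shows "Lp_norm M p (\<lambda>t. c * h t) \<le> c * Lp_norm M p h"
  using assms(1)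
proof (cases p rule: exponent_cases)
  case infinity
  have "AE t in M. c * h t \<le> c * esssup M h"
    using esssup_AE[of h M] by eventually_elim (rule mult_left_mono, auto)
  then show ?thesis unfolding infinity Lp_norm_infinity by (intro esssup_I) measurable
next
  case (real r)
  have "(\<integral>\<^sup>+t. enn_powr (c * h t) r \<partial>M) = enn_powr c r * (\<integral>\<^sup>+t. enn_powr (h t) r \<partial>M)"
    using real c by (subst nn_integral_cmult[symmetric]) (auto simp: enn_powr_mult)
  moreover have "enn_powr c r < \<infinity>" using c by simp
  ultimately show ?thesis using real by (simp add: Lp_norm_real enn_powr_mult enn_powr_powr)
qed

lemma Lp_norm_cmult:
  assumes "1 \<le> p" and [measurable]: "h \<in> borel_measurable M" and c: "c < \<infinity>"
  shows "Lp_norm M p (\<lambda>t. c * h t) = c * Lp_norm M p h"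
proof (cases "c = 0")
  case True
  then show ?thesis using Lp_norm_cmult_le[OF assms] by simp
next
  case False
  have inv: "inverse c < \<infinity>" using False by (simp add: less_top[symmetric])
  have one: "c * inverse c = 1" "inverse c * c = 1"
    using False c by (auto simp: ennreal_divide_self simp flip: divide_ennreal_def) (metis c divide_ennreal_def ennreal_divide_self infinity_ennreal_def mult.commute)
  have "Lp_norm M p h = Lp_norm M p (\<lambda>t. inverse c * (c * h t))"
    by (simp add: one flip: mult.assoc)
  also have "\<dots> \<le> inverse c * Lp_norm M p (\<lambda>t. c * h t)"
    by (rule Lp_norm_cmult_le[OF assms(1) _ inv]) measurable
  finally have "c * Lp_norm M p h \<le> c * (inverse c * Lp_norm M p (\<lambda>t. c * h t))"
    by (rule mult_left_mono) simp
  then have "c * Lp_norm M p h \<le> Lp_norm M p (\<lambda>t. c * h t)"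
    by (simp add: one flip: mult.assoc)
  then show ?thesis using Lp_norm_cmult_le[OF assms] by (rule antisym[rotated])
qed

text \<open>
  The Fatou property: monotone convergence for finite exponents; for the exponent \<open>\<infinity>\<close>, countably
  many almost everywhere bounds \<open>h j \<le> esssup M (h j)\<close> hold simultaneously. It allows a general
  function to be replaced by truncations all of whose norms are finite.
\<close>
lemma Lp_norm_SUP:
  fixes h :: "nat \<Rightarrow> 'a \<Rightarrow> ennreal"
  assumes "1 \<le> p" and [measurable]: "\<And>j. h j \<in> borel_measurable M"
    and inc: "\<And>t. t \<in> space M \<Longrightarrow> incseq (\<lambda>j. h j t)"
  shows "Lp_norm M p (\<lambda>t. SUP j. h j t) = (SUP j. Lp_norm M p (h j))"
  using assms(1)
proof (cases p rule: exponent_cases)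
  case infinity
  have "AE t in M. \<forall>j. h j t \<le> esssup M (h j)"
    by (simp add: AE_all_countable esssup_AE)
  then have "AE t in M. (SUP j. h j t) \<le> (SUP j. esssup M (h j))"
    by eventually_elim (auto intro!: SUP_mono)
  then have "esssup M (\<lambda>t. SUP j. h j t) \<le> (SUP j. esssup M (h j))"
    by (intro esssup_I) measurable
  moreover have "esssup M (h j) \<le> esssup M (\<lambda>t. SUP j. h j t)" for j
    by (rule esssup_mono) (auto intro: SUP_upper)
  ultimately show ?thesis unfolding infinity Lp_norm_infinity
    by (intro antisym SUP_least)
next
  case (real r)
  have "(\<integral>\<^sup>+t. enn_powr (SUP j. h j t) r \<partial>M) = (\<integral>\<^sup>+t. (SUP j. enn_powr (h j t) r) \<partial>M)"
    using real by (simp add: enn_powr_SUP)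
  also have "\<dots> = (SUP j. \<integral>\<^sup>+t. enn_powr (h j t) r \<partial>M)"
    using inc real by (intro nn_integral_monotone_convergence_SUP_AE AE_I2)
      (auto simp: incseq_def intro!: enn_powr_mono)
  finally show ?thesis using real by (simp add: Lp_norm_real enn_powr_SUP)
qed

lemma Lp_norm_eq_0_AE:
  assumes "1 \<le> p" and [measurable]: "h \<in> borel_measurable M" and "Lp_norm M p h = 0"
  shows "AE t in M. h t = 0"
  using assms(1)
proof (cases p rule: exponent_cases)
  case infinity
  then show ?thesis using assms(3) esssup_AE[of h M] by (simp add: Lp_norm_infinity)
next
  case (real r)
  then have "(\<integral>\<^sup>+t. enn_powr (h t) r \<partial>M) = 0" using assms(3) by (simp add: Lp_norm_real)
  then show ?thesis by (simp add: nn_integral_0_iff_AE)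
qed

lemma nn_integral_mult_le_esssup:
  assumes [measurable]: "f \<in> borel_measurable M" "g \<in> borel_measurable M"
  shows "(\<integral>\<^sup>+t. f t * g t \<partial>M) \<le> (\<integral>\<^sup>+t. f t \<partial>M) * esssup M g"
proof -
  have "(\<integral>\<^sup>+t. f t * g t \<partial>M) \<le> (\<integral>\<^sup>+t. f t * esssup M g \<partial>M)"
    using esssup_AE[of g M] by (intro nn_integral_mono_AE) (auto elim!: eventually_mono intro: mult_left_mono)
  also have "\<dots> = (\<integral>\<^sup>+t. f t \<partial>M) * esssup M g" by (rule nn_integral_multc) measurable
  finally show ?thesis .
qed

text \<open>
  The integral may be infinite and the norms \<open>0\<close> or \<open>\<infinity>\<close>. If a norm vanishes, so does the product
  almost everywhere, which matches \<open>0 * \<infinity> = 0\<close>; if both are positive and one is infinite there is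
  nothing to show; in the remaining case scaling reduces the claim to functions in the unit balls,
  where Young's inequality is integrated pointwise.
\<close>
lemma Lp_norm_Hoelder:
  assumes conj: "conjugate_exponents p q"
    and [measurable]: "f \<in> borel_measurable M" "g \<in> borel_measurable M"
  shows "(\<integral>\<^sup>+t. f t * g t \<partial>M) \<le> Lp_norm M p f * Lp_norm M q g"
  using conj
proof (cases rule: conjugate_exponents_cases)
  case one
  then show ?thesis using nn_integral_mult_le_esssup[of f M g] by (simp add: Lp_norm_one Lp_norm_infinity)
next
  case infinity
  then show ?thesis using nn_integral_mult_le_esssup[of g M f]
    by (simp add: Lp_norm_one Lp_norm_infinity mult.commute)
next
  case (real r s)
  have p1: "1 \<le> p" and q1: "1 \<le> q" using conjugate_exponents_ge_1[OF conj] by auto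
  have normalised: "(\<integral>\<^sup>+t. u t * v t \<partial>M) \<le> 1"
    if [measurable]: "u \<in> borel_measurable M" "v \<in> borel_measurable M"
      and "Lp_norm M p u \<le> 1" "Lp_norm M q v \<le> 1" for u v
  proof -
    have u: "(\<integral>\<^sup>+t. enn_powr (u t) r \<partial>M) \<le> 1" and v: "(\<integral>\<^sup>+t. enn_powr (v t) s \<partial>M) \<le> 1"
      using that real by (auto simp: Lp_norm_real enn_powr_le_1_iff)
    have "(\<integral>\<^sup>+t. u t * v t \<partial>M)
        \<le> (\<integral>\<^sup>+t. ennreal (1 / r) * enn_powr (u t) r + ennreal (1 / s) * enn_powr (v t) s \<partial>M)"
      by (intro nn_integral_mono enn_powr_Young real)
    also have "\<dots> = ennreal (1 / r) * (\<integral>\<^sup>+t. enn_powr (u t) r \<partial>M)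
        + ennreal (1 / s) * (\<integral>\<^sup>+t. enn_powr (v t) s \<partial>M)"
      by (simp add: nn_integral_add nn_integral_cmult)
    also have "\<dots> \<le> ennreal (1 / r) * 1 + ennreal (1 / s) * 1"
      by (intro add_mono mult_left_mono u v) auto
    also have "\<dots> = 1" using real by (simp flip: ennreal_plus)
    finally show ?thesis .
  qed
  let ?A = "Lp_norm M p f" and ?B = "Lp_norm M q g"
  consider "?A = 0 \<or> ?B = 0" | "?A \<noteq> 0" "?B \<noteq> 0" "?A = \<infinity> \<or> ?B = \<infinity>"
    | "?A \<noteq> 0" "?B \<noteq> 0" "?A < \<infinity>" "?B < \<infinity>"
    by (metis infinity_ennreal_def less_top)
  then show ?thesis
  proof cases
    case 1
    then have "AE t in M. f t * g t = 0"
      using Lp_norm_eq_0_AE[OF p1, of f M] Lp_norm_eq_0_AE[OF q1, of g M] by auto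
    then have "(\<integral>\<^sup>+t. f t * g t \<partial>M) = 0" by (simp add: nn_integral_0_iff_AE)
    then show ?thesis by simp
  next
    case 2
    then have "?A * ?B = \<infinity>" by (auto simp: ennreal_mult_eq_top_iff)
    then show ?thesis by (metis infinity_ennreal_def top_greatest)
  next
    case 3
    then obtain a b where a: "0 < a" "?A = ennreal a" and b: "0 < b" "?B = ennreal b"
      by (cases ?A; cases ?B) (auto simp: less_le)
    have "Lp_norm M p (\<lambda>t. ennreal (1 / a) * f t) \<le> 1" "Lp_norm M q (\<lambda>t. ennreal (1 / b) * g t) \<le> 1"
      using p1 q1 a b by (simp_all add: Lp_norm_cmult flip: ennreal_mult)
    from normalised[OF _ _ this]
    have le: "(\<integral>\<^sup>+t. (ennreal (1 / a) * f t) * (ennreal (1 / b) * g t) \<partial>M) \<le> 1" by simp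
    have ab: "ennreal a * ennreal b * (ennreal (1 / a) * ennreal (1 / b)) = 1"
      using a b by (simp flip: ennreal_mult)
    have "(\<integral>\<^sup>+t. f t * g t \<partial>M)
        = (\<integral>\<^sup>+t. (ennreal a * ennreal b) * ((ennreal (1 / a) * f t) * (ennreal (1 / b) * g t)) \<partial>M)"
    proof (rule nn_integral_cong)
      fix t
      have "(ennreal a * ennreal b) * ((ennreal (1 / a) * f t) * (ennreal (1 / b) * g t))
        = (ennreal a * ennreal b * (ennreal (1 / a) * ennreal (1 / b))) * (f t * g t)"
        by (simp only: ac_simps)
      then show "f t * g t = (ennreal a * ennreal b) * ((ennreal (1 / a) * f t) * (ennreal (1 / b) * g t))"
        by (simp add: ab)
    qed
    also have "\<dots> = (ennreal a * ennreal b) * (\<integral>\<^sup>+t. (ennreal (1 / a) * f t) * (ennreal (1 / b) * g t) \<partial>M)"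
      by (rule nn_integral_cmult) measurable
    also have "\<dots> \<le> ennreal a * ennreal b * 1" by (intro mult_left_mono le) auto
    finally show ?thesis by (simp add: a b)
  qed
qed

section \<open>Measurable dependence on parameters and almost norming functions\<close>

text \<open>
  A bound \<open>z\<close> is essential for the section \<open>h y\<close> exactly when the section of the measurable set where
  \<open>h\<close> exceeds \<open>z\<close> is null, and the measure of sections depends measurably on \<open>y\<close>.
\<close>
lemma (in sigma_finite_measure) borel_measurable_esssup [measurable (raw)]:
  fixes h :: "'b \<Rightarrow> 'a \<Rightarrow> ennreal"
  assumes h [measurable]: "case_prod h \<in> borel_measurable (N \<Otimes>\<^sub>M M)"
  shows "(\<lambda>y. esssup M (h y)) \<in> borel_measurable N"
proof (rule borel_measurableI_le)
  fix z :: ennreal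
  let ?A = "{x \<in> space (N \<Otimes>\<^sub>M M). z < case_prod h x}"
  have A: "?A \<in> sets (N \<Otimes>\<^sub>M M)" by measurable
  have "esssup M (h y) \<le> z \<longleftrightarrow> emeasure M (Pair y -` ?A) = 0" if y: "y \<in> space N" for y
  proof -
    have [measurable]: "h y \<in> borel_measurable M"
      using measurable_compose[OF measurable_Pair1'[OF y] h] by simp
    have "esssup M (h y) \<le> z \<longleftrightarrow> (AE t in M. h y t \<le> z)"
    proof
      assume "esssup M (h y) \<le> z"
      then show "AE t in M. h y t \<le> z"
        using esssup_AE[of "h y" M] by (auto elim!: eventually_mono)
    qed (auto intro!: esssup_I)
    also have "\<dots> \<longleftrightarrow> emeasure M {t \<in> space M. z < h y t} = 0"
      by (simp add: AE_iff_measurable[OF _ refl] not_le)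
    also have "{t \<in> space M. z < h y t} = Pair y -` ?A"
      using y by (auto simp: space_pair_measure)
    finally show ?thesis .
  qed
  then have "{y \<in> space N. esssup M (h y) \<le> z} = {y \<in> space N. emeasure M (Pair y -` ?A) = 0}"
    by auto
  also have "\<dots> \<in> sets N" using measurable_emeasure_Pair[OF A] by measurable
  finally show "{y \<in> space N. esssup M (h y) \<le> z} \<in> sets N" .
qed

lemma (in sigma_finite_measure) borel_measurable_Lp_norm [measurable (raw)]:
  assumes [measurable]: "case_prod h \<in> borel_measurable (N \<Otimes>\<^sub>M M)"
  shows "(\<lambda>y. Lp_norm M p (h y)) \<in> borel_measurable N"
  unfolding Lp_norm_def by (cases "p = \<infinity>") simp_all

text \<open>
  Duality between \<open>L\<^sup>1\<close> and \<open>L\<^sup>\<infinity>\<close>: the unit mass is placed where \<open>f y\<close> comes close to its essential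
  supremum. That set has positive but possibly infinite measure, so it is weighted by a strictly
  positive integrable function; \<open>c < 1\<close> is unavoidable because the essential supremum need not be
  attained. The function \<open>g\<close> is given by a formula in \<open>f\<close>, which makes it jointly measurable in the
  parameter and the variable.
\<close>
lemma (in sigma_finite_measure) esssup_near_extremal:
  fixes f :: "'b \<Rightarrow> 'a \<Rightarrow> ennreal"
  assumes c: "0 < c" "c < 1"
    and f [measurable]: "case_prod f \<in> borel_measurable (N \<Otimes>\<^sub>M M)"
    and fin: "\<And>y. y \<in> space N \<Longrightarrow> esssup M (f y) < \<infinity>"
  obtains g where "case_prod g \<in> borel_measurable (N \<Otimes>\<^sub>M M)"
    "\<And>y t. y \<in> space N \<Longrightarrow> t \<in> space M \<Longrightarrow> g y t < \<infinity>"
    "\<And>y. y \<in> space N \<Longrightarrow> (\<integral>\<^sup>+t. g y t \<partial>M) \<le> 1"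
    "\<And>y. y \<in> space N \<Longrightarrow> ennreal c * esssup M (f y) \<le> (\<integral>\<^sup>+t. f y t * g y t \<partial>M)"
proof -
  obtain w where w [measurable]: "w \<in> borel_measurable M" and wint: "integral\<^sup>N M w \<noteq> \<infinity>"
    and wpos: "\<And>t. t \<in> space M \<Longrightarrow> 0 < w t \<and> w t < \<infinity>"
    using Ex_finite_integrable_function by blast
  define E where "E y = esssup M (f y)" for y
  have [measurable]: "E \<in> borel_measurable N" unfolding E_def by measurable
  define v where "v y t = (if ennreal c * E y < f y t then w t else 0)" for y t
  have [measurable]: "case_prod v \<in> borel_measurable (N \<Otimes>\<^sub>M M)"
    unfolding v_def by measurable
  define W where "W y = (\<integral>\<^sup>+t. v y t \<partial>M)" for y
  have [measurable]: "W \<in> borel_measurable N" unfolding W_def by measurable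
  \<comment> \<open>If \<open>E y = 0\<close>, then \<open>W y\<close> is zero as well and there is nothing to norm.\<close>
  define g where "g y t = (if E y = 0 then 0 else ennreal (1 / enn2real (W y)) * v y t)" for y t
  have gm [measurable]: "case_prod g \<in> borel_measurable (N \<Otimes>\<^sub>M M)"
    unfolding g_def by measurable
  have gfin: "g y t < \<infinity>" if "y \<in> space N" "t \<in> space M" for y t
    using wpos[OF that(2)] by (auto simp: g_def v_def ennreal_mult_less_top)
  have Wfin: "W y < \<infinity>" for y
  proof -
    have "W y \<le> integral\<^sup>N M w" unfolding W_def v_def by (intro nn_integral_mono) auto
    then show ?thesis using wint by (auto simp: less_top[symmetric] top_unique)
  qed
  have fy [measurable]: "f y \<in> borel_measurable M" "v y \<in> borel_measurable M" "g y \<in> borel_measurable M"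
    if "y \<in> space N" for y
    using that by measurable
  have gint: "(\<integral>\<^sup>+t. g y t \<partial>M) = 1" if y: "y \<in> space N" "E y \<noteq> 0" for y
  proof -
    note [measurable] = fy[OF y(1)]
    have Ey: "E y < \<infinity>" using fin[OF y(1)] by (simp add: E_def)
    then have "ennreal c * E y < 1 * E y"
      using c y(2) by (intro ennreal_mult_strict_right_mono) (auto simp: less_top[symmetric] zero_less_iff_neq_zero ennreal_lessI)
    then have pos: "0 < emeasure M {t \<in> space M. ennreal c * E y < f y t}"
      using y by (intro esssup_pos_measure) (auto simp: E_def)
    have "W y \<noteq> 0"
    proof
      assume "W y = 0"
      then have "AE t in M. v y t = 0" by (simp add: W_def nn_integral_0_iff_AE)
      then have "AE t in M. \<not> ennreal c * E y < f y t"
        using AE_space by eventually_elim (use wpos in \<open>force simp: v_def split: if_splits\<close>)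
      then have "emeasure M {t \<in> space M. ennreal c * E y < f y t} = 0"
        by (simp add: AE_iff_measurable[OF _ refl])
      with pos show False by simp
    qed
    then obtain u where u: "0 < u" "W y = ennreal u"
      using Wfin[of y] by (cases "W y") (auto simp: less_le)
    have "(\<integral>\<^sup>+t. g y t \<partial>M) = ennreal (1 / enn2real (W y)) * W y"
      using y by (simp add: g_def W_def nn_integral_cmult)
    also have "\<dots> = 1" using u by (simp flip: ennreal_mult)
    finally show ?thesis .
  qed
  show ?thesis
  proof (rule that[OF gm gfin])
    fix y assume y: "y \<in> space N"
    note [measurable] = fy[OF y]
    show "(\<integral>\<^sup>+t. g y t \<partial>M) \<le> 1"
    proof (cases "E y = 0")
      case True
      then show ?thesis by (simp add: g_def)
    qed (use gint[OF y] in simp)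
    show "ennreal c * esssup M (f y) \<le> (\<integral>\<^sup>+t. f y t * g y t \<partial>M)"
    proof (cases "E y = 0")
      case True
      then show ?thesis by (simp add: E_def)
    next
      case False
      have "ennreal c * E y = (\<integral>\<^sup>+t. (ennreal c * E y) * g y t \<partial>M)"
        by (subst nn_integral_cmult) (simp_all add: gint[OF y False])
      also have "\<dots> \<le> (\<integral>\<^sup>+t. f y t * g y t \<partial>M)"
        by (intro nn_integral_mono) (auto simp: g_def v_def intro!: mult_right_mono)
      finally show ?thesis by (simp add: E_def)
    qed
  qed
qed

text \<open>
  The equality case of Hoelder's inequality: \<open>g = (f / \<parallel>f\<parallel>)\<^bsup>s - 1\<^esup>\<close>. For \<open>s = 1\<close> this is the indicator
  function of the set where \<open>f\<close> does not vanish, as \<open>0 powr 0 = 0\<close>, so that exponent requires no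
  separate construction.
\<close>
lemma (in sigma_finite_measure) Lp_norm_extremal_real:
  fixes f :: "'b \<Rightarrow> 'a \<Rightarrow> ennreal"
  assumes s: "1 \<le> s" and conj: "conjugate_exponents p (ennreal s)"
    and f [measurable]: "case_prod f \<in> borel_measurable (N \<Otimes>\<^sub>M M)"
    and f_fin: "\<And>y t. y \<in> space N \<Longrightarrow> t \<in> space M \<Longrightarrow> f y t < \<infinity>"
    and fin: "\<And>y. y \<in> space N \<Longrightarrow> Lp_norm M (ennreal s) (f y) < \<infinity>"
  obtains g where "case_prod g \<in> borel_measurable (N \<Otimes>\<^sub>M M)"
    "\<And>y t. y \<in> space N \<Longrightarrow> t \<in> space M \<Longrightarrow> g y t < \<infinity>"
    "\<And>y. y \<in> space N \<Longrightarrow> Lp_norm M p (g y) \<le> 1"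
    "\<And>y. y \<in> space N \<Longrightarrow> Lp_norm M (ennreal s) (f y) \<le> (\<integral>\<^sup>+t. f y t * g y t \<partial>M)"
proof -
  let ?q = "ennreal s"
  have q1: "1 \<le> ?q" and p1: "1 \<le> p" using conjugate_exponents_ge_1[OF conj] by auto
  define E where "E y = Lp_norm M ?q (f y)" for y
  have [measurable]: "E \<in> borel_measurable N" unfolding E_def by measurable
  define u where "u y t = ennreal (1 / enn2real (E y)) * f y t" for y t
  have um [measurable]: "case_prod u \<in> borel_measurable (N \<Otimes>\<^sub>M M)" unfolding u_def by measurable
  define g where "g y t = (if E y = 0 then 0 else enn_powr (u y t) (s - 1))" for y t
  have gm [measurable]: "case_prod g \<in> borel_measurable (N \<Otimes>\<^sub>M M)" unfolding g_def by measurable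
  have fy: "f y \<in> borel_measurable M" "u y \<in> borel_measurable M" "g y \<in> borel_measurable M"
    if "y \<in> space N" for y
    using that by measurable
  have uint: "(\<integral>\<^sup>+t. enn_powr (u y t) s \<partial>M) = 1" "\<exists>a>0. E y = ennreal a"
    if y: "y \<in> space N" "E y \<noteq> 0" for y
  proof -
    note [measurable] = fy[OF y(1)]
    obtain a where a: "0 < a" "E y = ennreal a"
      using fin[OF y(1)] y(2) by (cases "E y") (auto simp: less_le E_def)
    then show "\<exists>a>0. E y = ennreal a" by blast
    have "Lp_norm M ?q (u y) = ennreal (1 / enn2real (E y)) * E y"
      unfolding u_def E_def by (rule Lp_norm_cmult[OF q1]) auto
    also have "\<dots> = 1" using a by (simp flip: ennreal_mult)
    finally have "enn_powr (enn_powr (\<integral>\<^sup>+t. enn_powr (u y t) s \<partial>M) (1 / s)) s = 1"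
      using s by (simp add: Lp_norm_real)
    then show "(\<integral>\<^sup>+t. enn_powr (u y t) s \<partial>M) = 1" using s by (simp add: enn_powr_powr)
  qed
  show ?thesis
  proof (rule that[OF gm])
    fix y t assume "y \<in> space N" "t \<in> space M"
    then show "g y t < \<infinity>" using f_fin by (auto simp: g_def u_def ennreal_mult_less_top)
  next
    fix y assume y: "y \<in> space N"
    note [measurable] = fy[OF y]
    show "Lp_norm M p (g y) \<le> 1"
    proof (cases "E y = 0")
      case True
      then have "Lp_norm M p (g y) = Lp_norm M p (\<lambda>t. 0 * u y t)" by (simp add: g_def[abs_def])
      also have "\<dots> = 0 * Lp_norm M p (u y)" by (rule Lp_norm_cmult[OF p1]) auto
      finally show ?thesis by simp
    next
      case False
      from conj show ?thesis
      proof (cases rule: conjugate_exponents_cases)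
        case infinity
        then have "s = 1" using s by (simp flip: ennreal_1)
        have "g y t \<le> 1" if "t \<in> space M" for t
        proof -
          have "u y t \<noteq> \<infinity>" using f_fin[OF y that] by (auto simp: u_def ennreal_mult_eq_top_iff)
          then show ?thesis using \<open>s = 1\<close> by (simp add: g_def enn_powr_def flip: ennreal_1)
        qed
        then show ?thesis unfolding infinity Lp_norm_infinity by (intro esssup_I AE_I2) auto
      next
        case (real r s')
        have "s' = s" using real s by simp
        note real = real[unfolded this]
        have "(s - 1) * r = s" using real by (simp add: field_simps)
        then have "(\<integral>\<^sup>+t. enn_powr (g y t) r \<partial>M) = 1"
          using uint[OF y False] False by (simp add: g_def enn_powr_powr)
        then show ?thesis using real by (simp add: Lp_norm_real)
      qed auto
    qed
    show "Lp_norm M ?q (f y) \<le> (\<integral>\<^sup>+t. f y t * g y t \<partial>M)"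
    proof (cases "E y = 0")
      case False
      obtain a where a: "0 < a" "E y = ennreal a" using uint(2)[OF y False] by auto
      have "E y = E y * (\<integral>\<^sup>+t. enn_powr (u y t) s \<partial>M)" using uint[OF y False] by simp
      also have "\<dots> = (\<integral>\<^sup>+t. E y * enn_powr (u y t) s \<partial>M)" by (simp add: nn_integral_cmult)
      also have "\<dots> = (\<integral>\<^sup>+t. f y t * g y t \<partial>M)"
      proof (rule nn_integral_cong)
        fix t
        have "E y * enn_powr (u y t) s = (E y * u y t) * g y t"
          using False s by (simp add: g_def mult.assoc enn_powr_minus_1_mult)
        also have "E y * u y t = f y t"
          using a by (simp add: u_def flip: mult.assoc ennreal_mult)
        finally show "E y * enn_powr (u y t) s = f y t * g y t" .
      qed
      finally show ?thesis by (simp add: E_def)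
    qed (simp add: E_def)
  qed
qed

text \<open>
  Measurable selection of almost norming functions. The parameter \<open>y\<close> stands for the coordinates that
  are held fixed when the norm in one coordinate is taken; joint measurability of \<open>g\<close> is what allows
  the choices made for different coordinates to be multiplied together.
\<close>
lemma (in sigma_finite_measure) Lp_norm_near_extremal:
  fixes f :: "'b \<Rightarrow> 'a \<Rightarrow> ennreal"
  assumes conj: "conjugate_exponents p q" and c: "0 < c" "c < 1"
    and f [measurable]: "case_prod f \<in> borel_measurable (N \<Otimes>\<^sub>M M)"
    and f_fin: "\<And>y t. y \<in> space N \<Longrightarrow> t \<in> space M \<Longrightarrow> f y t < \<infinity>"
    and fin: "\<And>y. y \<in> space N \<Longrightarrow> Lp_norm M q (f y) < \<infinity>"
  obtains g where "case_prod g \<in> borel_measurable (N \<Otimes>\<^sub>M M)"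
    "\<And>y t. y \<in> space N \<Longrightarrow> t \<in> space M \<Longrightarrow> g y t < \<infinity>"
    "\<And>y. y \<in> space N \<Longrightarrow> Lp_norm M p (g y) \<le> 1"
    "\<And>y. y \<in> space N \<Longrightarrow> ennreal c * Lp_norm M q (f y) \<le> (\<integral>\<^sup>+t. f y t * g y t \<partial>M)"
proof -
  have "1 \<le> q" by (rule conjugate_exponents_ge_1[OF conj])
  then show ?thesis
  proof (cases q rule: exponent_cases)
    case infinity
    with conj have "p = 1" by (cases rule: conjugate_exponents_cases) auto
    have "\<And>y. y \<in> space N \<Longrightarrow> esssup M (f y) < \<infinity>" using fin infinity by (simp add: Lp_norm_infinity)
    from esssup_near_extremal[OF c f this] obtain g where
      "case_prod g \<in> borel_measurable (N \<Otimes>\<^sub>M M)"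
      "\<And>y t. y \<in> space N \<Longrightarrow> t \<in> space M \<Longrightarrow> g y t < \<infinity>"
      "\<And>y. y \<in> space N \<Longrightarrow> (\<integral>\<^sup>+t. g y t \<partial>M) \<le> 1"
      "\<And>y. y \<in> space N \<Longrightarrow> ennreal c * esssup M (f y) \<le> (\<integral>\<^sup>+t. f y t * g y t \<partial>M)"
      by blast
    then show ?thesis using that infinity \<open>p = 1\<close> by (simp add: Lp_norm_one Lp_norm_infinity)
  next
    case (real s)
    have "ennreal c * x \<le> x" for x :: ennreal
      using c mult_right_mono[of "ennreal c" 1 x] by simp
    note le = this
    have "\<And>y. y \<in> space N \<Longrightarrow> Lp_norm M (ennreal s) (f y) < \<infinity>" using fin real by simp
    from Lp_norm_extremal_real[OF real(1) conj[unfolded real(2)] f f_fin this]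
    obtain g where g: "case_prod g \<in> borel_measurable (N \<Otimes>\<^sub>M M)"
      "\<And>y t. y \<in> space N \<Longrightarrow> t \<in> space M \<Longrightarrow> g y t < \<infinity>"
      "\<And>y. y \<in> space N \<Longrightarrow> Lp_norm M p (g y) \<le> 1"
      "\<And>y. y \<in> space N \<Longrightarrow> Lp_norm M (ennreal s) (f y) \<le> (\<integral>\<^sup>+t. f y t * g y t \<partial>M)"
      by blast
    show ?thesis
      by (rule that[OF g(1-3)]) (use order.trans[OF le g(4)] real in simp_all)
  qed
qed

section \<open>Counting measure and completions\<close>

lemma infsum_ennreal_eq_nn_integral:
  fixes f :: "int \<Rightarrow> ennreal"
  shows "(\<Sum>\<^sub>\<infinity>k. f k) = (\<integral>\<^sup>+k. f k \<partial>count_space UNIV)"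
proof (rule antisym)
  have inf: "(\<Sum>\<^sub>\<infinity>k. f k) = (SUP F\<in>{F. finite F}. sum f F)"
    by (subst nonneg_infsum_complete) auto
  have fin: "sum f F = (\<integral>\<^sup>+k. f k * indicator F k \<partial>count_space UNIV)" if "finite F" for F
    using that by (simp add: nn_integral_count_space_finite flip: nn_integral_count_space_indicator)
  show "(\<Sum>\<^sub>\<infinity>k. f k) \<le> (\<integral>\<^sup>+k. f k \<partial>count_space UNIV)"
    unfolding inf
  proof (rule SUP_least)
    fix F :: "int set" assume "F \<in> {F. finite F}"
    then show "sum f F \<le> (\<integral>\<^sup>+k. f k \<partial>count_space UNIV)"
      by (auto simp: fin split: split_indicator intro!: nn_integral_mono)
  qed
  have "f k = (SUP j::nat. f k * indicator {-int j..int j} k)" for k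
  proof (rule antisym)
    show "f k \<le> (SUP j::nat. f k * indicator {-int j..int j} k)"
      by (rule SUP_upper2[of "nat \<bar>k\<bar>"]) (auto split: split_indicator)
  qed (auto intro!: SUP_least split: split_indicator)
  then have "(\<integral>\<^sup>+k. f k \<partial>count_space UNIV)
      = (\<integral>\<^sup>+k. (SUP j::nat. f k * indicator {-int j..int j} k) \<partial>count_space UNIV)"
    by (intro nn_integral_cong) simp
  also have "\<dots> = (SUP j. \<integral>\<^sup>+k. f k * indicator {-int j..int j} k \<partial>count_space UNIV)"
    by (rule nn_integral_monotone_convergence_SUP)
      (auto simp: incseq_def le_fun_def split: split_indicator)
  also have "\<dots> \<le> (\<Sum>\<^sub>\<infinity>k. f k)"
    unfolding inf by (rule SUP_least) (auto simp flip: fin intro!: SUP_upper)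
  finally show "(\<integral>\<^sup>+k. f k \<partial>count_space UNIV) \<le> (\<Sum>\<^sub>\<infinity>k. f k)" .
qed

text \<open>
  A counting measure has no nonempty null sets.
\<close>
lemma esssup_count_space:
  fixes f :: "'a \<Rightarrow> ennreal"
  shows "esssup (count_space UNIV) f = (SUP k. f k)"
proof (rule antisym)
  show "(SUP k. f k) \<le> esssup (count_space UNIV) f"
    using esssup_AE[of f "count_space UNIV"] by (auto simp: AE_count_space intro!: SUP_least)
qed (auto intro!: esssup_I SUP_upper AE_I2)

lemma Lp_norm_count_space_upper:
  fixes f :: "'a \<Rightarrow> ennreal"
  assumes "1 \<le> p"
  shows "f k \<le> Lp_norm (count_space UNIV) p f"
  using assms
proof (cases p rule: exponent_cases)
  case (real r)
  have "enn_powr (f k) r \<le> (\<integral>\<^sup>+k. enn_powr (f k) r \<partial>count_space UNIV)"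
    by (rule nn_integral_ge_point) simp
  from enn_powr_mono[OF this, of "1 / r"] real show ?thesis
    by (simp add: Lp_norm_real enn_powr_powr)
qed (simp add: Lp_norm_infinity esssup_count_space SUP_upper)

lemma Lp_norm_completion:
  assumes [measurable]: "h \<in> borel_measurable M"
  shows "Lp_norm (completion M) p h = Lp_norm M p h"
  by (simp add: Lp_norm_def nn_integral_completion esssup_eq_AE AE_completion_iff
      measurable_completion)

text \<open>
  The functions may be arbitrary: \<open>esssup\<close> is infinite on non-measurable functions, but over a complete
  measure equality almost everywhere preserves measurability. This covers the sections of a Lebesgue
  measurable function, some of which may fail to be measurable.
\<close>
lemma Lp_norm_cong_AE_completion:
  assumes "AE t in M. g t = h t"
  shows "Lp_norm (completion M) p g = Lp_norm (completion M) p h"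
proof -
  have ae: "AE t in completion M. g t = h t" using assms by (rule AE_completion)
  have meas: "v \<in> borel_measurable (completion M)"
    if [measurable]: "u \<in> borel_measurable (completion M)" and uv: "AE t in completion M. u t = v t"
    for u v :: "'a \<Rightarrow> ennreal"
  proof (rule measurableI)
    fix A :: "ennreal set" assume [measurable]: "A \<in> sets borel"
    show "v -` A \<inter> space (completion M) \<in> sets (completion M)"
    proof (rule completion.in_sets_AE)
      show "u -` A \<inter> space (completion M) \<in> sets (completion M)" by measurable
      show "AE t in completion M. t \<in> u -` A \<inter> space (completion M) \<longleftrightarrow> t \<in> v -` A \<inter> space (completion M)"
        using uv by eventually_elim simp
    qed auto
  qed simp
  have "AE t in completion M. h t = g t" using ae by eventually_elim simp
  then have iff: "g \<in> borel_measurable (completion M) \<longleftrightarrow> h \<in> borel_measurable (completion M)"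
    using meas ae by blast
  have "esssup (completion M) g = esssup (completion M) h"
    using iff ae by (cases "g \<in> borel_measurable (completion M)")
      (auto intro!: esssup_AE_cong simp: esssup_non_measurable)
  moreover have "(\<integral>\<^sup>+t. enn_powr (g t) r \<partial>completion M) = (\<integral>\<^sup>+t. enn_powr (h t) r \<partial>completion M)" for r
    using ae by (intro nn_integral_cong_AE) (auto elim!: eventually_mono)
  ultimately show ?thesis by (simp add: Lp_norm_def)
qed

section \<open>Dyadic shells\<close>

text \<open>
  The number of the only dyadic shell that contains \<open>t\<close>, if \<open>t \<noteq> 0\<close>; the origin is in no shell.
\<close>
definition shell_index :: "real \<Rightarrow> int" where
  "shell_index t = \<lfloor>log 2 \<bar>t\<bar>\<rfloor> + 1"

lemma mem_dyadic_shell_iff: "t \<in> dyadic_shell k \<longleftrightarrow> t \<noteq> 0 \<and> shell_index t = k"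
proof (cases "t = 0")
  case False
  have "shell_index t = k \<longleftrightarrow> \<lfloor>log 2 \<bar>t\<bar>\<rfloor> = k - 1" by (auto simp: shell_index_def)
  also have "\<dots> \<longleftrightarrow> 2 powr real_of_int (k - 1) \<le> \<bar>t\<bar> \<and> \<bar>t\<bar> < 2 powr (real_of_int (k - 1) + 1)"
    using False by (simp add: floor_log_eq_powr_iff)
  also have "\<dots> \<longleftrightarrow> t \<in> dyadic_shell k" by (auto simp: dyadic_shell_def abs_if)
  finally show ?thesis using False by simp
qed (simp add: dyadic_shell_def)

lemma dyadic_shell_measurable [measurable]: "dyadic_shell k \<in> sets borel"
  unfolding dyadic_shell_def by measurable

lemma shell_index_measurable [measurable]: "shell_index \<in> borel \<rightarrow>\<^sub>M count_space UNIV"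
  unfolding shell_index_def by measurable

lemma emeasure_dyadic_shell_finite: "emeasure lborel (dyadic_shell k) < \<infinity>"
proof -
  have "emeasure lborel (dyadic_shell k) \<le> emeasure lborel {- (2 powr real_of_int k)..2 powr real_of_int k}"
    by (rule emeasure_mono) (auto simp: dyadic_shell_def)
  also have "\<dots> < \<infinity>" by simp
  finally show ?thesis .
qed

lemma nn_integral_dyadic_shells:
  fixes f :: "real \<Rightarrow> ennreal"
  assumes [measurable]: "f \<in> borel_measurable borel"
  shows "(\<integral>\<^sup>+t. f t \<partial>lborel)
    = (\<integral>\<^sup>+k. (\<integral>\<^sup>+t. f t * indicator (dyadic_shell k) t \<partial>lborel) \<partial>count_space UNIV)"
proof -
  have "f t = (\<integral>\<^sup>+k. f t * indicator (dyadic_shell k) t \<partial>count_space UNIV)" if "t \<noteq> 0" for t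
  proof -
    have "(\<integral>\<^sup>+k. f t * indicator (dyadic_shell k) t \<partial>count_space UNIV)
      = (\<integral>\<^sup>+k. f t * indicator {shell_index t} k \<partial>count_space UNIV)"
      using that by (intro nn_integral_cong) (auto simp: mem_dyadic_shell_iff split: split_indicator)
    then show ?thesis by (simp add: nn_integral_cmult)
  qed
  moreover have "AE t in lborel. t \<noteq> (0::real)" by (rule AE_lborel_singleton)
  ultimately have "(\<integral>\<^sup>+t. f t \<partial>lborel)
      = (\<integral>\<^sup>+t. (\<integral>\<^sup>+k. f t * indicator (dyadic_shell k) t \<partial>count_space UNIV) \<partial>lborel)"
    by (intro nn_integral_cong_AE) (auto elim!: eventually_mono)
  also have "\<dots> = (\<integral>\<^sup>+k. (\<integral>\<^sup>+t. f t * indicator (dyadic_shell k) t \<partial>lborel) \<partial>count_space UNIV)"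
    by (intro nn_integral_count_space_nn_integral) auto
  finally show ?thesis .
qed

section \<open>Herz norms on the line\<close>

text \<open>
  The Herz norm is itself a mixed norm, \<open>L\<^sup>q\<close> in a variable of a shell and then \<open>\<ell>\<^sup>p\<close> in the number of
  the shell, so the facts about \<open>Lp_norm\<close> are applied twice, to Lebesgue measure and to counting measure.
\<close>
lemma herz_norm_eq_lebesgue:
  assumes "1 \<le> p"
  shows "herz_norm \<alpha> p q h = Lp_norm (count_space UNIV) p
    (\<lambda>k. ennreal (2 powr (real_of_int k * \<alpha>)) * Lp_norm lebesgue q (\<lambda>t. h t * indicator (dyadic_shell k) t))"
  using assms
proof (cases p rule: exponent_cases)
  case infinity
  then show ?thesis
    by (simp add: herz_norm_def Lp_norm_infinity esssup_count_space Lq_norm_eq_Lp_norm)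
next
  case (real r)
  have "ennreal (2 powr (real_of_int k * r * \<alpha>)) = enn_powr (ennreal (2 powr (real_of_int k * \<alpha>))) r" for k
    by (simp add: enn_powr_ennreal powr_powr mult.assoc mult.commute[of r])
  then have "ennreal (2 powr (real_of_int k * r * \<alpha>)) * enn_powr x r
      = enn_powr (ennreal (2 powr (real_of_int k * \<alpha>)) * x) r" for k x
    using real by (simp add: enn_powr_mult)
  with real show ?thesis
    by (simp add: herz_norm_def Lp_norm_real Lq_norm_eq_Lp_norm infsum_ennreal_eq_nn_integral)
qed

definition shell_norm :: "real \<Rightarrow> ennreal \<Rightarrow> (real \<Rightarrow> ennreal) \<Rightarrow> int \<Rightarrow> ennreal" where
  "shell_norm \<alpha> q h k =
     ennreal (2 powr (real_of_int k * \<alpha>)) * Lp_norm lborel q (\<lambda>t. h t * indicator (dyadic_shell k) t)"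

lemma herz_norm_eq:
  assumes "1 \<le> p" and [measurable]: "h \<in> borel_measurable borel"
  shows "herz_norm \<alpha> p q h = Lp_norm (count_space UNIV) p (shell_norm \<alpha> q h)"
  using assms(1) by (simp add: herz_norm_eq_lebesgue shell_norm_def[abs_def] Lp_norm_completion)

lemma herz_norm_cong_AE:
  assumes "1 \<le> p" "AE t in lborel. g t = h t"
  shows "herz_norm \<alpha> p q g = herz_norm \<alpha> p q h"
proof -
  have "Lp_norm lebesgue q (\<lambda>t. g t * indicator (dyadic_shell k) t)
    = Lp_norm lebesgue q (\<lambda>t. h t * indicator (dyadic_shell k) t)" for k
    using assms(2) by (intro Lp_norm_cong_AE_completion) (auto elim!: eventually_mono)
  then show ?thesis using assms(1) by (simp add: herz_norm_eq_lebesgue)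
qed

lemma herz_norm_mono:
  assumes pq: "1 \<le> p" "1 \<le> q" and [measurable]: "g \<in> borel_measurable borel" "h \<in> borel_measurable borel"
    and le: "\<And>t. g t \<le> h t"
  shows "herz_norm \<alpha> p q g \<le> herz_norm \<alpha> p q h"
proof -
  have "Lp_norm lborel q (\<lambda>t. g t * indicator (dyadic_shell k) t)
    \<le> Lp_norm lborel q (\<lambda>t. h t * indicator (dyadic_shell k) t)" for k
    using pq by (intro Lp_norm_mono_AE AE_I2 mult_right_mono le) auto
  then have "shell_norm \<alpha> q g k \<le> shell_norm \<alpha> q h k" for k
    unfolding shell_norm_def by (intro mult_left_mono) auto
  then show ?thesis using pq by (simp add: herz_norm_eq Lp_norm_mono_AE)
qed

lemma herz_norm_cmult:
  assumes pq: "1 \<le> p" "1 \<le> q" and [measurable]: "h \<in> borel_measurable borel" and c: "c < \<infinity>"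
  shows "herz_norm \<alpha> p q (\<lambda>t. c * h t) = c * herz_norm \<alpha> p q h"
proof -
  have "shell_norm \<alpha> q (\<lambda>t. c * h t) = (\<lambda>k. c * shell_norm \<alpha> q h k)"
    using pq c by (simp add: shell_norm_def[abs_def] Lp_norm_cmult mult.assoc mult.left_commute)
  then show ?thesis using pq c by (simp add: herz_norm_eq Lp_norm_cmult)
qed

lemma herz_norm_SUP:
  fixes h :: "nat \<Rightarrow> real \<Rightarrow> ennreal"
  assumes pq: "1 \<le> p" "1 \<le> q" and [measurable]: "\<And>j. h j \<in> borel_measurable borel"
    and inc: "\<And>t. incseq (\<lambda>j. h j t)"
  shows "herz_norm \<alpha> p q (\<lambda>t. SUP j. h j t) = (SUP j. herz_norm \<alpha> p q (h j))"
proof -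
  have inc': "incseq (\<lambda>j. h j t * indicator (dyadic_shell k) t)" for t k
    using inc[of t] by (auto simp: incseq_def split: split_indicator)
  have shell: "shell_norm \<alpha> q (\<lambda>t. SUP j. h j t) k = (SUP j. shell_norm \<alpha> q (h j) k)" for k
  proof -
    have "Lp_norm lborel q (\<lambda>t. (SUP j. h j t) * indicator (dyadic_shell k) t)
      = Lp_norm lborel q (\<lambda>t. SUP j. h j t * indicator (dyadic_shell k) t)"
      by (simp add: SUP_mult_right_ennreal)
    also have "\<dots> = (SUP j. Lp_norm lborel q (\<lambda>t. h j t * indicator (dyadic_shell k) t))"
      using pq inc' by (intro Lp_norm_SUP) auto
    finally show ?thesis by (simp add: shell_norm_def SUP_mult_left_ennreal)
  qed
  have shell_inc: "incseq (\<lambda>j. shell_norm \<alpha> q (h j) k)" for k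
    unfolding shell_norm_def using pq inc'
    by (auto simp: incseq_def intro!: mult_left_mono Lp_norm_mono_AE AE_I2)
  have "herz_norm \<alpha> p q (\<lambda>t. SUP j. h j t)
    = Lp_norm (count_space UNIV) p (\<lambda>k. SUP j. shell_norm \<alpha> q (h j) k)"
    using pq by (simp add: herz_norm_eq flip: shell)
  also have "\<dots> = (SUP j. Lp_norm (count_space UNIV) p (shell_norm \<alpha> q (h j)))"
    using pq shell_inc by (intro Lp_norm_SUP) auto
  finally show ?thesis using pq by (simp add: herz_norm_eq)
qed

text \<open>
  Hoelder's inequality on each shell and then over the shells; the weights \<open>2\<^bsup>k \<alpha>\<^esup>\<close> and \<open>2\<^bsup>- k \<alpha>\<^esup>\<close> cancel.
\<close>
lemma herz_norm_Hoelder: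
  assumes conj: "conjugate_exponents p p'" "conjugate_exponents q q'"
    and [measurable]: "f \<in> borel_measurable borel" "g \<in> borel_measurable borel"
  shows "(\<integral>\<^sup>+t. f t * g t \<partial>lborel) \<le> herz_norm (- \<alpha>) p' q' f * herz_norm \<alpha> p q g"
proof -
  have conj': "conjugate_exponents p' p" "conjugate_exponents q' q"
    by (rule conj[THEN conjugate_exponents_sym])+
  have shell: "(\<integral>\<^sup>+t. f t * g t * indicator (dyadic_shell k) t \<partial>lborel)
      \<le> shell_norm (- \<alpha>) q' f k * shell_norm \<alpha> q g k" for k
  proof -
    have "(\<integral>\<^sup>+t. f t * g t * indicator (dyadic_shell k) t \<partial>lborel)
      = (\<integral>\<^sup>+t. (f t * indicator (dyadic_shell k) t) * (g t * indicator (dyadic_shell k) t) \<partial>lborel)"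
      by (intro nn_integral_cong) (auto split: split_indicator)
    also have "\<dots> \<le> Lp_norm lborel q' (\<lambda>t. f t * indicator (dyadic_shell k) t)
        * Lp_norm lborel q (\<lambda>t. g t * indicator (dyadic_shell k) t)"
      by (rule Lp_norm_Hoelder[OF conj'(2)]) auto
    also have "\<dots> = (ennreal (2 powr (real_of_int k * - \<alpha>)) * ennreal (2 powr (real_of_int k * \<alpha>))) *
        (Lp_norm lborel q' (\<lambda>t. f t * indicator (dyadic_shell k) t)
        * Lp_norm lborel q (\<lambda>t. g t * indicator (dyadic_shell k) t))"
      by (simp flip: ennreal_mult powr_add)
    also have "\<dots> = shell_norm (- \<alpha>) q' f k * shell_norm \<alpha> q g k"
      by (simp only: shell_norm_def ac_simps)
    finally show ?thesis .
  qed
  have "(\<integral>\<^sup>+t. f t * g t \<partial>lborel)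
    = (\<integral>\<^sup>+k. (\<integral>\<^sup>+t. f t * g t * indicator (dyadic_shell k) t \<partial>lborel) \<partial>count_space UNIV)"
    by (rule nn_integral_dyadic_shells) measurable
  also have "\<dots> \<le> (\<integral>\<^sup>+k. shell_norm (- \<alpha>) q' f k * shell_norm \<alpha> q g k \<partial>count_space UNIV)"
    by (intro nn_integral_mono shell)
  also have "\<dots> \<le> Lp_norm (count_space UNIV) p' (shell_norm (- \<alpha>) q' f)
      * Lp_norm (count_space UNIV) p (shell_norm \<alpha> q g)"
    by (rule Lp_norm_Hoelder[OF conj'(1)]) auto
  also have "\<dots> = herz_norm (- \<alpha>) p' q' f * herz_norm \<alpha> p q g"
    using conjugate_exponents_ge_1[OF conj(1)] by (simp add: herz_norm_eq)
  finally show ?thesis .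
qed

lemma measurable_indicator_dyadic_shell:
  "(\<lambda>((y, k), t). indicator (dyadic_shell k) t :: ennreal)
    \<in> borel_measurable ((N \<Otimes>\<^sub>M count_space UNIV) \<Otimes>\<^sub>M lborel)"
proof -
  have "(\<lambda>((y, k), t). indicator (dyadic_shell k) t :: ennreal)
    = (\<lambda>z. if snd z \<noteq> 0 \<and> shell_index (snd z) = snd (fst z) then 1 else 0)"
    by (auto simp: fun_eq_iff mem_dyadic_shell_iff)
  also have "\<dots> \<in> borel_measurable ((N \<Otimes>\<^sub>M count_space UNIV) \<Otimes>\<^sub>M lborel)"
    by measurable
  finally show ?thesis .
qed

lemma measurable_mult_shell:
  fixes h :: "'b \<Rightarrow> real \<Rightarrow> ennreal"
  assumes [measurable]: "case_prod h \<in> borel_measurable (N \<Otimes>\<^sub>M lborel)"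
  shows "(\<lambda>(z, t). h (fst z) t * indicator (dyadic_shell (snd z)) t)
    \<in> borel_measurable ((N \<Otimes>\<^sub>M count_space UNIV) \<Otimes>\<^sub>M lborel)"
proof -
  have "(\<lambda>(z, t). h (fst z) t * indicator (dyadic_shell (snd z)) t)
    = (\<lambda>z. case_prod h (fst (fst z), snd z) * (\<lambda>((y, k), t). indicator (dyadic_shell k) t) z)"
    by (auto simp: fun_eq_iff)
  also have "\<dots> \<in> borel_measurable ((N \<Otimes>\<^sub>M count_space UNIV) \<Otimes>\<^sub>M lborel)"
    using measurable_indicator_dyadic_shell[of N] by measurable
  finally show ?thesis .
qed

lemma measurable_shell_norm:
  fixes h :: "'b \<Rightarrow> real \<Rightarrow> ennreal"
  assumes "case_prod h \<in> borel_measurable (N \<Otimes>\<^sub>M lborel)"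
  shows "(\<lambda>(y, k). shell_norm \<alpha> q (h y) k) \<in> borel_measurable (N \<Otimes>\<^sub>M count_space UNIV)"
proof -
  have [measurable]: "(\<lambda>z. Lp_norm lborel q (\<lambda>t. h (fst z) t * indicator (dyadic_shell (snd z)) t))
    \<in> borel_measurable (N \<Otimes>\<^sub>M count_space UNIV)"
    using measurable_mult_shell[OF assms] by (intro lborel.borel_measurable_Lp_norm) simp
  show ?thesis unfolding shell_norm_def split_beta' by measurable
qed

lemma measurable_herz_norm:
  fixes h :: "'b \<Rightarrow> real \<Rightarrow> ennreal"
  assumes p: "1 \<le> p" and h [measurable]: "case_prod h \<in> borel_measurable (N \<Otimes>\<^sub>M lborel)"
  shows "(\<lambda>y. herz_norm \<alpha> p q (h y)) \<in> borel_measurable N"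
proof -
  interpret sigma_finite_measure "count_space (UNIV :: int set)"
    by (rule sigma_finite_measure_count_space)
  have "(\<lambda>y. Lp_norm (count_space UNIV) p (shell_norm \<alpha> q (h y))) \<in> borel_measurable N"
    by (rule borel_measurable_Lp_norm) (use measurable_shell_norm[OF h] in simp)
  moreover have "herz_norm \<alpha> p q (h y) = Lp_norm (count_space UNIV) p (shell_norm \<alpha> q (h y))"
    if y: "y \<in> space N" for y
    using measurable_compose[OF measurable_Pair1'[OF y] h] p by (intro herz_norm_eq) simp_all
  ultimately show ?thesis by (simp cong: measurable_cong)
qed

text \<open>
  An almost norming function is chosen on each shell for the exponent \<open>q'\<close>, and an almost norming
  sequence for the sequence of shell norms and the exponent \<open>p'\<close>; the first are combined with the
  second as coefficients.
\<close>
lemma herz_norm_near_extremal: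
  fixes f :: "'b \<Rightarrow> real \<Rightarrow> ennreal"
  assumes conj: "conjugate_exponents p p'" "conjugate_exponents q q'" and c: "0 < c" "c < 1"
    and f [measurable]: "case_prod f \<in> borel_measurable (N \<Otimes>\<^sub>M lborel)"
    and f_fin: "\<And>y t. y \<in> space N \<Longrightarrow> f y t < \<infinity>"
    and fin: "\<And>y. y \<in> space N \<Longrightarrow> herz_norm (- \<alpha>) p' q' (f y) < \<infinity>"
  obtains g where "case_prod g \<in> borel_measurable (N \<Otimes>\<^sub>M lborel)"
    "\<And>y t. y \<in> space N \<Longrightarrow> g y t < \<infinity>"
    "\<And>y. y \<in> space N \<Longrightarrow> herz_norm \<alpha> p q (g y) \<le> 1"
    "\<And>y. y \<in> space N \<Longrightarrow> ennreal c * herz_norm (- \<alpha>) p' q' (f y) \<le> (\<integral>\<^sup>+t. f y t * g y t \<partial>lborel)"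
proof -
  interpret C: sigma_finite_measure "count_space (UNIV :: int set)"
    by (rule sigma_finite_measure_count_space)
  note ge1 = conjugate_exponents_ge_1[OF conj(1)] conjugate_exponents_ge_1[OF conj(2)]
  \<comment> \<open>Both choices lose a factor, so each is made with the constant \<open>sqrt c\<close>.\<close>
  define d where "d = sqrt c"
  have d: "0 < d" "d < 1" using c by (auto simp: d_def)
  have dd: "ennreal d * ennreal d = ennreal c" using c by (simp add: d_def flip: ennreal_mult)
  have fy: "f y \<in> borel_measurable borel" if "y \<in> space N" for y
    using measurable_compose[OF measurable_Pair1'[OF that] f] by simp
  define a where "a y k = shell_norm (- \<alpha>) q' (f y) k" for y k
  have a_meas: "case_prod a \<in> borel_measurable (N \<Otimes>\<^sub>M count_space UNIV)"
    unfolding a_def by (rule measurable_shell_norm[OF f])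
  have herz_eq: "herz_norm (- \<alpha>) p' q' (f y) = Lp_norm (count_space UNIV) p' (a y)"
    if "y \<in> space N" for y
    using ge1 fy[OF that] by (simp add: herz_norm_eq a_def[abs_def])
  have a_norm: "Lp_norm (count_space UNIV) p' (a y) < \<infinity>" if "y \<in> space N" for y
    using fin[OF that] herz_eq[OF that] by simp
  have a_fin: "a y k < \<infinity>" if "y \<in> space N" for y k
    using Lp_norm_count_space_upper[OF ge1(2), of "a y" k] a_norm[OF that] by (rule le_less_trans)
  obtain b where b_meas [measurable]: "case_prod b \<in> borel_measurable (N \<Otimes>\<^sub>M count_space UNIV)"
    and b_fin: "\<And>y k. y \<in> space N \<Longrightarrow> b y k < \<infinity>"
    and b_norm: "\<And>y. y \<in> space N \<Longrightarrow> Lp_norm (count_space UNIV) p (b y) \<le> 1"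
    and b_ext: "\<And>y. y \<in> space N \<Longrightarrow>
      ennreal d * Lp_norm (count_space UNIV) p' (a y) \<le> (\<integral>\<^sup>+k. a y k * b y k \<partial>count_space UNIV)"
    using C.Lp_norm_near_extremal[OF conj(1) d a_meas a_fin a_norm] by auto
  let ?f = "\<lambda>z t. f (fst z) t * indicator (dyadic_shell (snd z)) t"
  have f_norm: "Lp_norm lborel q' (?f z) < \<infinity>" if "z \<in> space (N \<Otimes>\<^sub>M count_space UNIV)" for z
    using a_fin[of "fst z" "snd z"] that
    by (auto simp: a_def shell_norm_def space_pair_measure ennreal_mult_less_top)
  have f_fin': "?f z t < \<infinity>" if "z \<in> space (N \<Otimes>\<^sub>M count_space UNIV)" for z t
    using f_fin that by (auto simp: space_pair_measure split: split_indicator)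
  obtain s where s_meas [measurable]:
      "case_prod s \<in> borel_measurable ((N \<Otimes>\<^sub>M count_space UNIV) \<Otimes>\<^sub>M lborel)"
    and s_fin: "\<And>z t. z \<in> space (N \<Otimes>\<^sub>M count_space UNIV) \<Longrightarrow> t \<in> space lborel \<Longrightarrow> s z t < \<infinity>"
    and s_norm: "\<And>z. z \<in> space (N \<Otimes>\<^sub>M count_space UNIV) \<Longrightarrow> Lp_norm lborel q (s z) \<le> 1"
    and s_ext: "\<And>z. z \<in> space (N \<Otimes>\<^sub>M count_space UNIV) \<Longrightarrow>
      ennreal d * Lp_norm lborel q' (?f z) \<le> (\<integral>\<^sup>+t. ?f z t * s z t \<partial>lborel)"
    using lborel.Lp_norm_near_extremal[OF conj(2) d measurable_mult_shell[OF f] f_fin' f_norm]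
    by blast
  have sp: "(y, k) \<in> space (N \<Otimes>\<^sub>M count_space UNIV)" if "y \<in> space N" for y k
    using that by (simp add: space_pair_measure)
  define e where "e k = ennreal (2 powr (real_of_int k * - \<alpha>))" for k :: int
  have e_fin: "e k < \<infinity>" for k by (simp add: e_def)
  \<comment> \<open>At the origin the value is irrelevant: it lies in no shell and is a null set.\<close>
  define g where "g y t = e (shell_index t) * b y (shell_index t) * s (y, shell_index t) t" for y t
  have g_meas [measurable]: "case_prod g \<in> borel_measurable (N \<Otimes>\<^sub>M lborel)"
  proof -
    have [measurable]: "(\<lambda>z. case_prod b (fst z, shell_index (snd z))) \<in> borel_measurable (N \<Otimes>\<^sub>M lborel)"
      by (rule measurable_compose[OF _ b_meas]) measurable
    have [measurable]: "(\<lambda>z. case_prod s ((fst z, shell_index (snd z)), snd z)) \<in> borel_measurable (N \<Otimes>\<^sub>M lborel)"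
      by (rule measurable_compose[OF _ s_meas]) measurable
    have "case_prod g = (\<lambda>z. e (shell_index (snd z)) * case_prod b (fst z, shell_index (snd z))
        * case_prod s ((fst z, shell_index (snd z)), snd z))"
      by (auto simp: fun_eq_iff g_def)
    also have "\<dots> \<in> borel_measurable (N \<Otimes>\<^sub>M lborel)" by measurable
    finally show ?thesis .
  qed
  have gy: "g y \<in> borel_measurable borel" if "y \<in> space N" for y
    using measurable_compose[OF measurable_Pair1'[OF that] g_meas] by simp
  have sy: "s (y, k) \<in> borel_measurable borel" if "y \<in> space N" for y k
    using measurable_compose[OF measurable_Pair1'[OF sp[OF that]] s_meas] by simp
  have g_shell: "g y t * indicator (dyadic_shell k) t
      = (e k * b y k) * (s (y, k) t * indicator (dyadic_shell k) t)" for y t k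
    by (auto simp: g_def mem_dyadic_shell_iff split: split_indicator)
  show ?thesis
  proof (rule that[OF g_meas])
    fix y t assume y: "y \<in> space N"
    show "g y t < \<infinity>"
      using b_fin[OF y] s_fin[OF sp[OF y]] e_fin by (simp add: g_def ennreal_mult_less_top)
  next
    fix y assume y: "y \<in> space N"
    note [measurable] = fy[OF y] gy[OF y] sy[OF y]
    have "shell_norm \<alpha> q (g y) k \<le> b y k" for k
    proof -
      have "Lp_norm lborel q (\<lambda>t. g y t * indicator (dyadic_shell k) t)
        = (e k * b y k) * Lp_norm lborel q (\<lambda>t. s (y, k) t * indicator (dyadic_shell k) t)"
        unfolding g_shell using ge1 b_fin[OF y] e_fin
        by (intro Lp_norm_cmult) (auto simp: ennreal_mult_less_top)
      also have "\<dots> \<le> (e k * b y k) * Lp_norm lborel q (s (y, k))"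
        using ge1 by (intro mult_left_mono Lp_norm_mono_AE AE_I2) (auto split: split_indicator)
      also have "\<dots> \<le> (e k * b y k) * 1"
        by (intro mult_left_mono s_norm sp y) auto
      finally have "shell_norm \<alpha> q (g y) k \<le> ennreal (2 powr (real_of_int k * \<alpha>)) * (e k * b y k)"
        unfolding shell_norm_def by (intro mult_left_mono) auto
      also have "\<dots> = b y k"
        by (simp add: e_def flip: mult.assoc ennreal_mult powr_add)
      finally show ?thesis .
    qed
    then have "herz_norm \<alpha> p q (g y) \<le> Lp_norm (count_space UNIV) p (b y)"
      using ge1 by (simp add: herz_norm_eq Lp_norm_mono_AE)
    then show "herz_norm \<alpha> p q (g y) \<le> 1" using b_norm[OF y] by (rule order.trans)
    have shell: "ennreal d * (a y k * b y k) \<le> (\<integral>\<^sup>+t. f y t * g y t * indicator (dyadic_shell k) t \<partial>lborel)" for k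
    proof -
      have "ennreal d * (a y k * b y k)
        = (e k * b y k) * (ennreal d * Lp_norm lborel q' (?f (y, k)))"
        by (simp add: a_def shell_norm_def e_def ac_simps)
      also have "\<dots> \<le> (e k * b y k) * (\<integral>\<^sup>+t. ?f (y, k) t * s (y, k) t \<partial>lborel)"
        by (intro mult_left_mono s_ext sp y) auto
      also have "\<dots> = (\<integral>\<^sup>+t. (e k * b y k) * (?f (y, k) t * s (y, k) t) \<partial>lborel)"
        by (rule nn_integral_cmult[symmetric]) simp
      also have "\<dots> = (\<integral>\<^sup>+t. f y t * g y t * indicator (dyadic_shell k) t \<partial>lborel)"
      proof (rule nn_integral_cong)
        fix t
        have "f y t * g y t * indicator (dyadic_shell k) t = f y t * (g y t * indicator (dyadic_shell k) t)"
          by (simp add: mult.assoc)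
        then show "(e k * b y k) * (?f (y, k) t * s (y, k) t) = f y t * g y t * indicator (dyadic_shell k) t"
          unfolding g_shell by (simp add: ac_simps)
      qed
      finally show ?thesis .
    qed
    have "ennreal c * herz_norm (- \<alpha>) p' q' (f y)
      = ennreal d * (ennreal d * Lp_norm (count_space UNIV) p' (a y))"
      by (simp add: herz_eq[OF y] dd flip: mult.assoc)
    also have "\<dots> \<le> ennreal d * (\<integral>\<^sup>+k. a y k * b y k \<partial>count_space UNIV)"
      by (intro mult_left_mono b_ext y) auto
    also have "\<dots> = (\<integral>\<^sup>+k. ennreal d * (a y k * b y k) \<partial>count_space UNIV)"
      by (rule nn_integral_cmult[symmetric]) simp
    also have "\<dots> \<le> (\<integral>\<^sup>+k. (\<integral>\<^sup>+t. f y t * g y t * indicator (dyadic_shell k) t \<partial>lborel) \<partial>count_space UNIV)"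
      by (intro nn_integral_mono shell)
    also have "\<dots> = (\<integral>\<^sup>+t. f y t * g y t \<partial>lborel)"
      by (rule nn_integral_dyadic_shells[symmetric]) measurable
    finally show "ennreal c * herz_norm (- \<alpha>) p' q' (f y) \<le> (\<integral>\<^sup>+t. f y t * g y t \<partial>lborel)" .
  qed
qed

text \<open>
  An increasing sequence of sets that exhausts the line. Each meets only finitely many shells, so its
  indicator function has finite Herz norm for all exponents and weights. The origin is included so that
  the union is the whole line.
\<close>
definition annulus :: "nat \<Rightarrow> real set" where
  "annulus j = {t. t = 0 \<or> \<bar>shell_index t\<bar> \<le> int j}"

lemma annulus_measurable [measurable]: "annulus j \<in> sets borel"
proof -
  have "annulus j = {0} \<union> shell_index -` {- int j..int j}"
    by (auto simp: annulus_def)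
  also have "\<dots> \<in> sets borel"
    using measurable_sets[OF shell_index_measurable, of "{- int j..int j}"] by auto
  finally show ?thesis .
qed

lemma annulus_mono: "i \<le> j \<Longrightarrow> annulus i \<subseteq> annulus j"
  by (auto simp: annulus_def)

lemma mem_annulus_nat: "t \<in> annulus (nat \<bar>shell_index t\<bar>)"
  by (simp add: annulus_def)

lemma Lp_norm_finite_if_bounded:
  assumes "1 \<le> p" and [measurable]: "A \<in> sets M" and A: "emeasure M A < \<infinity>"
    and [measurable]: "h \<in> borel_measurable M"
    and C: "C < \<infinity>" and le: "\<And>t. t \<in> space M \<Longrightarrow> h t \<le> C * indicator A t"
  shows "Lp_norm M p h < \<infinity>"
  using assms(1)
proof (cases p rule: exponent_cases)
  case infinity
  have "h t \<le> C" if "t \<in> space M" for t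
    using le[OF that] by (auto split: split_indicator_asm)
  then have "esssup M h \<le> C" by (intro esssup_I AE_I2) auto
  also note C
  finally show ?thesis unfolding infinity Lp_norm_infinity .
next
  case (real r)
  have "(\<integral>\<^sup>+t. enn_powr (h t) r \<partial>M) \<le> (\<integral>\<^sup>+t. enn_powr C r * indicator A t \<partial>M)"
  proof (rule nn_integral_mono)
    fix t assume "t \<in> space M"
    then have "enn_powr (h t) r \<le> enn_powr (C * indicator A t) r"
      using le real by (intro enn_powr_mono) auto
    then show "enn_powr (h t) r \<le> enn_powr C r * indicator A t" by (auto split: split_indicator)
  qed
  also have "\<dots> = enn_powr C r * emeasure M A" by (simp add: nn_integral_cmult)
  also have "\<dots> < \<infinity>" using A C by (simp add: ennreal_mult_less_top)
  finally show ?thesis using real by (simp add: Lp_norm_real)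
qed

lemma herz_norm_annulus_finite:
  assumes "1 \<le> p" "1 \<le> q"
  shows "herz_norm \<alpha> p q (indicator (annulus j)) < \<infinity>"
proof -
  let ?I = "{- int j..int j}"
  let ?a = "shell_norm \<alpha> q (indicator (annulus j))"
  have fin: "?a k < \<infinity>" for k
  proof -
    have "Lp_norm lborel q (\<lambda>t. indicator (annulus j) t * indicator (dyadic_shell k) t) < \<infinity>"
      using emeasure_dyadic_shell_finite[of k] assms(2)
      by (intro Lp_norm_finite_if_bounded[where A = "dyadic_shell k" and C = 1])
        (auto split: split_indicator)
    then show ?thesis by (simp add: shell_norm_def ennreal_mult_less_top)
  qed
  have zero: "?a k = 0" if "k \<notin> ?I" for k
  proof -
    have "(\<lambda>t. indicator (annulus j) t * indicator (dyadic_shell k) t) = (\<lambda>t. 0 * 0 :: ennreal)"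
      using that by (auto simp: fun_eq_iff annulus_def mem_dyadic_shell_iff split: split_indicator)
    then have "Lp_norm lborel q (\<lambda>t. indicator (annulus j) t * indicator (dyadic_shell k) t)
      = Lp_norm lborel q (\<lambda>t::real. 0 * 0)" by (rule arg_cong[where f = "Lp_norm lborel q"])
    also have "\<dots> = 0" using assms(2) by (subst Lp_norm_cmult) auto
    finally show ?thesis by (simp add: shell_norm_def)
  qed
  have "Lp_norm (count_space UNIV) p ?a < \<infinity>"
  proof (rule Lp_norm_finite_if_bounded[where A = ?I and C = "\<Sum>k\<in>?I. ?a k"])
    fix k :: int
    show "?a k \<le> (\<Sum>k\<in>?I. ?a k) * indicator ?I k"
      using zero[of k] by (auto split: split_indicator intro: member_le_sum)
  qed (use assms fin in \<open>auto simp: less_top[symmetric]\<close>)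
  then show ?thesis using assms by (simp add: herz_norm_eq)
qed

section \<open>Product Lebesgue measure along one coordinate\<close>

abbreviation lborel_n :: "nat \<Rightarrow> (nat \<Rightarrow> real) measure" where
  "lborel_n n \<equiv> \<Pi>\<^sub>M i\<in>{1..n}. lborel"

interpretation lborel_product: product_sigma_finite "\<lambda>_ :: nat. lborel :: real measure"
  by (rule product_sigma_finite.intro) (rule lborel.sigma_finite_measure_axioms)

lemma fun_upd_in_space_lborel_n:
  "x \<in> space (lborel_n n) \<Longrightarrow> i \<in> {1..n} \<Longrightarrow> x(i := t) \<in> space (lborel_n n)"
  by (auto simp: space_PiM PiE_iff extensional_def)

lemma measurable_upd_lborel_n:
  assumes "i \<in> {1..n}"
  shows "(\<lambda>(x, t). x(i := t)) \<in> lborel_n n \<Otimes>\<^sub>M lborel \<rightarrow>\<^sub>M lborel_n n"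
proof -
  have ins: "insert i {1..n} = {1..n}" using assms by auto
  show ?thesis
    using measurable_add_dim[of i "{1..n}" "\<lambda>_. lborel :: real measure"] unfolding ins .
qed

lemma measurable_slice:
  assumes "F \<in> borel_measurable (lborel_n n)" "i \<in> {1..n}"
  shows "case_prod (\<lambda>x t. F (x(i := t))) \<in> borel_measurable (lborel_n n \<Otimes>\<^sub>M lborel)"
  using measurable_compose[OF measurable_upd_lborel_n[OF assms(2)] assms(1)]
  by (simp add: split_beta')

lemma measurable_slice_at:
  assumes "F \<in> borel_measurable (lborel_n n)" "i \<in> {1..n}" "x \<in> space (lborel_n n)"
  shows "(\<lambda>t. F (x(i := t))) \<in> borel_measurable borel"
  using measurable_compose[OF measurable_Pair1'[OF assms(3)] measurable_slice[OF assms(1,2)]] by simp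

text \<open>
  Tonelli's theorem for the indicator function of an exceptional null set. The integral of that function
  along the coordinate \<open>i\<close> does not depend on \<open>x i\<close> and can be regarded as a function on all of
  \<open>lborel_n n\<close>, so that iterating the lemma needs no change of the underlying space.
\<close>
lemma AE_lborel_n_slice:
  assumes "AE x in lborel_n n. Q x" and i: "i \<in> {1..n}"
  shows "AE x in lborel_n n. AE t in lborel. Q (x(i := t))"
proof -
  from assms(1) obtain N where sub: "{x \<in> space (lborel_n n). \<not> Q x} \<subseteq> N"
    and N0: "emeasure (lborel_n n) N = 0" and N: "N \<in> sets (lborel_n n)"
    by (rule AE_E)
  let ?I = "{1..n} - {i}"
  have ins: "insert i ?I = {1..n}" using i by auto
  have ind: "(indicator N :: _ \<Rightarrow> ennreal) \<in> borel_measurable (lborel_n n)" using N by simp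
  define h where "h x = (\<integral>\<^sup>+t. indicator N (x(i := t)) \<partial>lborel :: ennreal)" for x
  have h_meas [measurable]: "h \<in> borel_measurable (lborel_n n)"
    unfolding h_def by (rule lborel.borel_measurable_nn_integral) (rule measurable_slice[OF ind i])
  have "(\<integral>\<^sup>+x. h x \<partial>lborel_n n) = (\<integral>\<^sup>+s. (\<integral>\<^sup>+x. h (x(i := s)) \<partial>PiM ?I (\<lambda>_. lborel)) \<partial>lborel)"
    by (rule lborel_product.product_nn_integral_insert_rev[of ?I i h, unfolded ins]) (use h_meas in auto)
  also have "\<dots> = (\<integral>\<^sup>+s. (\<integral>\<^sup>+x. h x \<partial>PiM ?I (\<lambda>_. lborel)) \<partial>(lborel :: real measure))"
    by (simp add: h_def)
  also have "(\<integral>\<^sup>+x. h x \<partial>PiM ?I (\<lambda>_. lborel)) = emeasure (lborel_n n) N"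
    using lborel_product.product_nn_integral_insert[of ?I i "indicator N", unfolded ins, OF _ _ ind] N
    by (simp add: h_def)
  finally have "AE x in lborel_n n. h x = 0" using N0 by (simp add: nn_integral_0_iff_AE[OF h_meas] del: One_nat_def)
  then show ?thesis using AE_space
  proof eventually_elim
    fix x assume h0: "h x = 0" and x: "x \<in> space (lborel_n n)"
    have "AE t in lborel. (indicator N (x(i := t)) :: ennreal) = 0"
      using h0 measurable_slice_at[OF ind i x] by (simp add: h_def nn_integral_0_iff_AE)
    then show "AE t in lborel. Q (x(i := t))"
      by eventually_elim
        (use sub fun_upd_in_space_lborel_n[OF x i] in \<open>auto split: split_indicator_asm\<close>)
  qed
qed

text \<open>
  The measure of the whole space is positive. Once all coordinates have been integrated out, equality
  almost everywhere thereby becomes equality.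
\<close>
lemma AE_lborel_n_const: "(AE x in lborel_n n. P) \<longleftrightarrow> P"
proof -
  have "emeasure (lborel_n n) (space (lborel_n n)) = (\<Prod>i\<in>{1..n}. emeasure lborel (UNIV :: real set))"
    unfolding space_PiM by (subst lborel_product.emeasure_PiM) auto
  also have "\<dots> \<noteq> 0" by simp
  finally show ?thesis by (cases P) (auto simp: AE_iff_measurable[OF _ refl])
qed

section \<open>Iterated integrals\<close>

text \<open>
  The integral in the coordinates \<open>1, \<dots>, k\<close>, by the same recursion as \<open>herz_iter\<close>, so that the two can be
  compared one coordinate at a time.
\<close>
primrec nn_integral_iter :: "nat \<Rightarrow> ((nat \<Rightarrow> real) \<Rightarrow> ennreal) \<Rightarrow> (nat \<Rightarrow> real) \<Rightarrow> ennreal" where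
  "nn_integral_iter 0 F = F"
| "nn_integral_iter (Suc k) F = (\<lambda>x. \<integral>\<^sup>+t. nn_integral_iter k F (x(Suc k := t)) \<partial>lborel)"

lemma nn_integral_iter_depends:
  assumes "\<And>i. i \<notin> {1..k} \<Longrightarrow> x i = y i"
  shows "nn_integral_iter k F x = nn_integral_iter k F y"
  using assms
proof (induction k arbitrary: x y)
  case 0
  then have "x = y" by (intro ext) simp
  then show ?case by simp
next
  case (Suc k)
  have "nn_integral_iter k F (x(Suc k := t)) = nn_integral_iter k F (y(Suc k := t))" for t
    by (rule Suc.IH) (use Suc.prems in auto)
  then show ?case by simp
qed

lemma nn_integral_iter_base_point:
  assumes "x \<in> space (lborel_n n)"
  shows "nn_integral_iter n F (\<lambda>_. undefined) = nn_integral_iter n F x"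
  using assms by (intro nn_integral_iter_depends) (auto simp: space_PiM PiE_iff extensional_def)

lemma nn_integral_iter_fun_upd:
  assumes "k < m"
  shows "nn_integral_iter k (\<lambda>x. F (x(m := t))) x = nn_integral_iter k F (x(m := t))"
  using assms
proof (induction k arbitrary: x)
  case (Suc k)
  have "x(Suc k := s, m := t) = x(m := t, Suc k := s)" for s
    using Suc.prems by (intro fun_upd_twist) auto
  then show ?case using Suc by (simp del: fun_upd_apply)
qed simp

lemma nn_integral_lborel_n:
  assumes "F \<in> borel_measurable (lborel_n n)"
  shows "(\<integral>\<^sup>+x. F x \<partial>lborel_n n) = nn_integral_iter n F (\<lambda>_. undefined)"
  using assms
proof (induction n arbitrary: F)
  case 0
  then show ?case by (simp add: PiM_empty nn_integral_count_space_finite)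
next
  case (Suc n)
  have ins: "{1..Suc n} = insert (Suc n) {1..n}" by auto
  have F: "F \<in> borel_measurable (PiM (insert (Suc n) {1..n}) (\<lambda>_. lborel))"
    using Suc.prems by (simp only: ins)
  have "(\<lambda>x. x(Suc n := t)) \<in> lborel_n n \<rightarrow>\<^sub>M PiM (insert (Suc n) {1..n}) (\<lambda>_. lborel)" for t
    by (rule measurable_fun_upd) auto
  then have slice: "(\<lambda>x. F (x(Suc n := t))) \<in> borel_measurable (lborel_n n)" for t
    using F by (rule measurable_compose)
  have "(\<integral>\<^sup>+x. F x \<partial>lborel_n (Suc n))
    = (\<integral>\<^sup>+t. (\<integral>\<^sup>+x. F (x(Suc n := t)) \<partial>lborel_n n) \<partial>lborel)"
    unfolding ins by (rule lborel_product.product_nn_integral_insert_rev[OF _ _ F]) auto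
  also have "\<dots> = (\<integral>\<^sup>+t. nn_integral_iter n F ((\<lambda>_. undefined)(Suc n := t)) \<partial>lborel)"
    by (simp add: Suc.IH[OF slice] nn_integral_iter_fun_upd del: One_nat_def fun_upd_apply)
  finally show ?case by simp
qed

lemma nn_integral_iter_measurable:
  assumes "F \<in> borel_measurable (lborel_n n)" "k \<le> n"
  shows "nn_integral_iter k F \<in> borel_measurable (lborel_n n)"
  using assms(2)
proof (induction k)
  case (Suc k)
  then have "nn_integral_iter k F \<in> borel_measurable (lborel_n n)" and k: "Suc k \<in> {1..n}" by auto
  from lborel.borel_measurable_nn_integral[OF measurable_slice[OF this]] show ?case by simp
qed (use assms in simp)

lemma nn_integral_iter_multc:
  assumes F: "F \<in> borel_measurable (lborel_n n)" and "k \<le> n"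
    and G: "\<And>x i t. x \<in> space (lborel_n n) \<Longrightarrow> i \<in> {1..k} \<Longrightarrow> G (x(i := t)) = G x"
    and "x \<in> space (lborel_n n)"
  shows "nn_integral_iter k (\<lambda>x. F x * G x) x = nn_integral_iter k F x * G x"
  using assms(2-)
proof (induction k arbitrary: x)
  case (Suc k)
  have k: "Suc k \<in> {1..n}" using Suc.prems by simp
  note upd = fun_upd_in_space_lborel_n[OF Suc.prems(3) k]
  have [measurable]: "(\<lambda>t. nn_integral_iter k F (x(Suc k := t))) \<in> borel_measurable borel"
    using Suc.prems by (intro measurable_slice_at[OF nn_integral_iter_measurable[OF F] k]) auto
  have "nn_integral_iter k (\<lambda>x. F x * G x) (x(Suc k := t)) = nn_integral_iter k F (x(Suc k := t)) * G x" for t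
    using Suc.IH[OF _ _ upd] Suc.prems by (simp del: fun_upd_apply)
  then show ?case by (simp add: nn_integral_multc)
qed simp

section \<open>Iterated Herz norms\<close>

lemma herz_iter_depends:
  assumes "\<And>i. i \<notin> {1..k} \<Longrightarrow> x i = y i"
  shows "herz_iter \<alpha> p q k F x = herz_iter \<alpha> p q k F y"
  using assms
proof (induction k arbitrary: x y)
  case 0
  then have "x = y" by (intro ext) simp
  then show ?case by simp
next
  case (Suc k)
  have "herz_iter \<alpha> p q k F (x(Suc k := t)) = herz_iter \<alpha> p q k F (y(Suc k := t))" for t
    by (rule Suc.IH) (use Suc.prems in auto)
  then show ?case by simp
qed

lemma herz_iter_base_point:
  assumes "x \<in> space (lborel_n n)"
  shows "herz_iter \<alpha> p q n F (\<lambda>_. undefined) = herz_iter \<alpha> p q n F x"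
  using assms by (intro herz_iter_depends) (auto simp: space_PiM PiE_iff extensional_def)

lemma herz_iter_cong:
  assumes "k \<le> n" "\<And>x. x \<in> space (lborel_n n) \<Longrightarrow> F x = G x" "x \<in> space (lborel_n n)"
  shows "herz_iter \<alpha> p q k F x = herz_iter \<alpha> p q k G x"
  using assms(1,3)
proof (induction k arbitrary: x)
  case (Suc k)
  then show ?case using fun_upd_in_space_lborel_n[OF Suc.prems(2), of "Suc k"] by simp
qed (simp add: assms(2))

lemma herz_iter_cong_AE:
  assumes p: "\<And>i. i \<in> {1..n} \<Longrightarrow> 1 \<le> p i"
    and "AE x in lborel_n n. F x = G x" and "k \<le> n"
  shows "AE x in lborel_n n. herz_iter \<alpha> p q k F x = herz_iter \<alpha> p q k G x"
  using assms(3)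
proof (induction k)
  case (Suc k)
  then have k: "Suc k \<in> {1..n}" by simp
  have "AE x in lborel_n n. herz_iter \<alpha> p q k F x = herz_iter \<alpha> p q k G x"
    using Suc by simp
  from AE_lborel_n_slice[OF this k] show ?case
    by eventually_elim (use p[OF k] in \<open>simp add: herz_norm_cong_AE\<close>)
qed (simp add: assms(2))

text \<open>
  Equality almost everywhere in \<open>x\<close> is inherited by the norms in the first \<open>k\<close> coordinates, seen as
  functions of the others, and the norm in all coordinates is a constant.
\<close>
lemma herz_iter_full_cong_AE:
  assumes p: "\<And>i. i \<in> {1..n} \<Longrightarrow> 1 \<le> p i" and "AE x in lborel_n n. F x = G x"
  shows "herz_iter \<alpha> p q n F (\<lambda>_. undefined) = herz_iter \<alpha> p q n G (\<lambda>_. undefined)"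
proof -
  have "AE x in lborel_n n. herz_iter \<alpha> p q n F x = herz_iter \<alpha> p q n G x"
    by (rule herz_iter_cong_AE[OF p assms(2)]) auto
  then have "AE x in lborel_n n. herz_iter \<alpha> p q n F (\<lambda>_. undefined) = herz_iter \<alpha> p q n G (\<lambda>_. undefined)"
    using AE_space by eventually_elim (simp add: herz_iter_base_point)
  then show ?thesis by (simp only: AE_lborel_n_const)
qed

lemma herz_iter_measurable:
  assumes p: "\<And>i. i \<in> {1..n} \<Longrightarrow> 1 \<le> p i"
    and F: "F \<in> borel_measurable (lborel_n n)" and "k \<le> n"
  shows "herz_iter \<alpha> p q k F \<in> borel_measurable (lborel_n n)"
  using assms(3)
proof (induction k)
  case (Suc k)
  then have k: "Suc k \<in> {1..n}" and "herz_iter \<alpha> p q k F \<in> borel_measurable (lborel_n n)" by auto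
  from measurable_herz_norm[OF p[OF k] measurable_slice[OF this(2) k]] show ?case by simp
qed (use F in simp)

context
  fixes n :: nat and \<alpha> :: "nat \<Rightarrow> real" and p q :: "nat \<Rightarrow> ennreal"
  assumes p: "\<And>i. i \<in> {1..n} \<Longrightarrow> 1 \<le> p i" and q: "\<And>i. i \<in> {1..n} \<Longrightarrow> 1 \<le> q i"
begin

lemma herz_iter_slice_measurable:
  assumes "F \<in> borel_measurable (lborel_n n)" "Suc k \<le> n" "x \<in> space (lborel_n n)"
  shows "(\<lambda>t. herz_iter \<alpha> p q k F (x(Suc k := t))) \<in> borel_measurable borel"
  using assms by (intro measurable_slice_at[OF herz_iter_measurable[OF p assms(1)]]) auto

lemma herz_iter_mono:
  assumes F: "F \<in> borel_measurable (lborel_n n)" and G: "G \<in> borel_measurable (lborel_n n)"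
    and le: "\<And>x. x \<in> space (lborel_n n) \<Longrightarrow> F x \<le> G x"
    and "k \<le> n" "x \<in> space (lborel_n n)"
  shows "herz_iter \<alpha> p q k F x \<le> herz_iter \<alpha> p q k G x"
  using assms(4,5)
proof (induction k arbitrary: x)
  case (Suc k)
  have k: "Suc k \<in> {1..n}" using Suc.prems by simp
  have "herz_iter \<alpha> p q k F (x(Suc k := t)) \<le> herz_iter \<alpha> p q k G (x(Suc k := t))" for t
    using Suc.prems k by (intro Suc.IH fun_upd_in_space_lborel_n) auto
  then show ?case
    using Suc.prems F G p[OF k] q[OF k] by (simp add: herz_norm_mono herz_iter_slice_measurable)
qed (simp add: le)

lemma herz_iter_multc:
  assumes F: "F \<in> borel_measurable (lborel_n n)" and "k \<le> n"
    and G: "\<And>x i t. x \<in> space (lborel_n n) \<Longrightarrow> i \<in> {1..k} \<Longrightarrow> G (x(i := t)) = G x"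
    and fin: "\<And>x. x \<in> space (lborel_n n) \<Longrightarrow> G x < \<infinity>" and "x \<in> space (lborel_n n)"
  shows "herz_iter \<alpha> p q k (\<lambda>x. F x * G x) x = herz_iter \<alpha> p q k F x * G x"
  using assms(2,3,5)
proof (induction k arbitrary: x)
  case (Suc k)
  have k: "Suc k \<in> {1..n}" using Suc.prems by simp
  note upd = fun_upd_in_space_lborel_n[OF Suc.prems(3) k]
  have "herz_iter \<alpha> p q k (\<lambda>x. F x * G x) (x(Suc k := t)) = G x * herz_iter \<alpha> p q k F (x(Suc k := t))" for t
    using Suc.IH[OF _ _ upd] Suc.prems by (simp add: mult.commute del: fun_upd_apply)
  then show ?case
    using Suc.prems F fin p[OF k] q[OF k]
    by (simp add: herz_norm_cmult herz_iter_slice_measurable mult.commute)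
qed simp

lemma herz_iter_SUP:
  fixes F :: "nat \<Rightarrow> (nat \<Rightarrow> real) \<Rightarrow> ennreal"
  assumes F: "\<And>j. F j \<in> borel_measurable (lborel_n n)"
    and inc: "\<And>x. x \<in> space (lborel_n n) \<Longrightarrow> incseq (\<lambda>j. F j x)"
    and "k \<le> n" "x \<in> space (lborel_n n)"
  shows "herz_iter \<alpha> p q k (\<lambda>x. SUP j. F j x) x = (SUP j. herz_iter \<alpha> p q k (F j) x)"
  using assms(3,4)
proof (induction k arbitrary: x)
  case (Suc k)
  have k: "Suc k \<in> {1..n}" using Suc.prems by simp
  note upd = fun_upd_in_space_lborel_n[OF Suc.prems(2) k]
  have "incseq (\<lambda>j. herz_iter \<alpha> p q k (F j) (x(Suc k := t)))" for t
    using inc Suc.prems upd by (auto simp: incseq_def intro!: herz_iter_mono F)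
  moreover have "herz_iter \<alpha> p q k (\<lambda>x. SUP j. F j x) (x(Suc k := t))
      = (SUP j. herz_iter \<alpha> p q k (F j) (x(Suc k := t)))" for t
    using Suc.prems upd by (intro Suc.IH) (auto simp del: fun_upd_apply)
  ultimately show ?case
    using Suc.prems F p[OF k] q[OF k] by (simp add: herz_norm_SUP herz_iter_slice_measurable)
qed simp

text \<open>
  Each step multiplies the bound by the finite Herz norm of the indicator function of \<open>annulus j\<close>: after
  \<open>k\<close> steps there remains a constant times the indicator function of the box in the other coordinates.
\<close>
lemma herz_iter_finite:
  assumes F: "F \<in> borel_measurable (lborel_n n)" and C: "C < \<infinity>"
    and le: "\<And>x. x \<in> space (lborel_n n) \<Longrightarrow> F x \<le> C * indicator {x. \<forall>i\<in>{1..n}. x i \<in> annulus j} x"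
    and "k \<le> n"
  shows "\<forall>x\<in>space (lborel_n n). herz_iter \<alpha> p q k F x < \<infinity>"
proof -
  have "\<exists>D<\<infinity>. \<forall>x\<in>space (lborel_n n).
      herz_iter \<alpha> p q k F x \<le> D * indicator {x. \<forall>i\<in>{Suc k..n}. x i \<in> annulus j} x"
    using \<open>k \<le> n\<close>
  proof (induction k)
    case 0
    then show ?case using C le by auto
  next
    case (Suc k)
    then obtain D where D: "D < \<infinity>" and bound: "\<And>x. x \<in> space (lborel_n n) \<Longrightarrow>
      herz_iter \<alpha> p q k F x \<le> D * indicator {x. \<forall>i\<in>{Suc k..n}. x i \<in> annulus j} x" by auto
    have k: "Suc k \<in> {1..n}" using Suc.prems by simp
    have split: "{Suc k..n} = insert (Suc k) {Suc (Suc k)..n}" using Suc.prems by auto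
    let ?H = "herz_norm (\<alpha> (Suc k)) (p (Suc k)) (q (Suc k)) (indicator (annulus j))"
    let ?D = "D * ?H"
    have "?D < \<infinity>" using D herz_norm_annulus_finite[OF p[OF k] q[OF k]] by (simp add: ennreal_mult_less_top)
    moreover have "herz_iter \<alpha> p q (Suc k) F x \<le> ?D * indicator {x. \<forall>i\<in>{Suc (Suc k)..n}. x i \<in> annulus j} x"
      if x: "x \<in> space (lborel_n n)" for x
    proof -
      let ?E = "D * indicator {x. \<forall>i\<in>{Suc (Suc k)..n}. x i \<in> annulus j} x"
      have E: "?E < \<infinity>" using D by (auto simp: ennreal_mult_less_top split: split_indicator)
      have "herz_iter \<alpha> p q k F (x(Suc k := t)) \<le> ?E * indicator (annulus j) t" for t
      proof -
        have "indicator {x. \<forall>i\<in>{Suc k..n}. x i \<in> annulus j} (x(Suc k := t))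
          = (indicator {x. \<forall>i\<in>{Suc (Suc k)..n}. x i \<in> annulus j} x * indicator (annulus j) t :: ennreal)"
          unfolding split by (auto simp: indicator_def)
        then show ?thesis
          using bound[OF fun_upd_in_space_lborel_n[OF x k, of t]] by (simp add: mult.assoc)
      qed
      then have "herz_iter \<alpha> p q (Suc k) F x
        \<le> herz_norm (\<alpha> (Suc k)) (p (Suc k)) (q (Suc k)) (\<lambda>t. ?E * indicator (annulus j) t)"
        using p[OF k] q[OF k] Suc.prems F x by (simp, intro herz_norm_mono herz_iter_slice_measurable) auto
      also have "\<dots> = ?E * ?H" using p[OF k] q[OF k] E by (intro herz_norm_cmult) auto
      finally show ?thesis by (simp add: ac_simps)
    qed
    ultimately show ?case by blast
  qed
  then obtain D where D: "D < \<infinity>" and bound: "\<And>x. x \<in> space (lborel_n n) \<Longrightarrow>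
      herz_iter \<alpha> p q k F x \<le> D * indicator {x. \<forall>i\<in>{Suc k..n}. x i \<in> annulus j} x" by auto
  show ?thesis
  proof
    fix x assume x: "x \<in> space (lborel_n n)"
    have "D * indicator {x. \<forall>i\<in>{Suc k..n}. x i \<in> annulus j} x < \<infinity>"
      using D by (auto simp: ennreal_mult_less_top split: split_indicator)
    with bound[OF x] show "herz_iter \<alpha> p q k F x < \<infinity>" by (rule le_less_trans)
  qed
qed

end

section \<open>Duality of iterated Herz norms\<close>

context
  fixes n :: nat and \<alpha> :: "nat \<Rightarrow> real" and p q p' q' :: "nat \<Rightarrow> ennreal"
  assumes conj_p: "\<And>i. i \<in> {1..n} \<Longrightarrow> conjugate_exponents (p i) (p' i)"
    and conj_q: "\<And>i. i \<in> {1..n} \<Longrightarrow> conjugate_exponents (q i) (q' i)"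
begin

lemma exponents_ge_1:
  "i \<in> {1..n} \<Longrightarrow> 1 \<le> p i" "i \<in> {1..n} \<Longrightarrow> 1 \<le> q i"
  "i \<in> {1..n} \<Longrightarrow> 1 \<le> p' i" "i \<in> {1..n} \<Longrightarrow> 1 \<le> q' i"
  using conjugate_exponents_ge_1 conj_p conj_q by blast+

lemma herz_iter_Hoelder:
  assumes F: "F \<in> borel_measurable (lborel_n n)" and G: "G \<in> borel_measurable (lborel_n n)"
    and "k \<le> n" "x \<in> space (lborel_n n)"
  shows "nn_integral_iter k (\<lambda>x. F x * G x) x
    \<le> herz_iter (\<lambda>i. - \<alpha> i) p' q' k F x * herz_iter \<alpha> p q k G x"
  using assms(3,4)
proof (induction k arbitrary: x)
  case (Suc k)
  have k: "Suc k \<in> {1..n}" using Suc.prems by simp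
  note upd = fun_upd_in_space_lborel_n[OF Suc.prems(2) k]
  have "nn_integral_iter (Suc k) (\<lambda>x. F x * G x) x
    \<le> (\<integral>\<^sup>+t. herz_iter (\<lambda>i. - \<alpha> i) p' q' k F (x(Suc k := t)) * herz_iter \<alpha> p q k G (x(Suc k := t)) \<partial>lborel)"
    unfolding nn_integral_iter.simps using Suc.prems by (intro nn_integral_mono Suc.IH upd) auto
  also have "\<dots> \<le> herz_iter (\<lambda>i. - \<alpha> i) p' q' (Suc k) F x * herz_iter \<alpha> p q (Suc k) G x"
    unfolding herz_iter.simps using Suc.prems exponents_ge_1 F G
    by (intro herz_norm_Hoelder conj_p conj_q k herz_iter_slice_measurable) auto
  finally show ?case .
qed simp

text \<open>
  The almost norming function for \<open>k + 1\<close> coordinates is a product \<open>g \<cdot> u\<close>. The factor \<open>g\<close> almost norms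
  \<open>F\<close> in the first \<open>k\<close> coordinates, and \<open>u\<close> almost norms, in the coordinate \<open>k + 1\<close>, the norm of \<open>F\<close> in
  the first \<open>k\<close>. As \<open>u\<close> does not depend on the first \<open>k\<close> coordinates, it is a scalar for the inner norms
  and the inner integrals.
\<close>
lemma herz_iter_near_extremal:
  assumes c: "0 < c" "c < 1" and F: "F \<in> borel_measurable (lborel_n n)"
    and fin: "\<And>k x. k \<le> n \<Longrightarrow> x \<in> space (lborel_n n) \<Longrightarrow> herz_iter (\<lambda>i. - \<alpha> i) p' q' k F x < \<infinity>"
    and "k \<le> n"
  shows "\<exists>g\<in>borel_measurable (lborel_n n). \<forall>x\<in>space (lborel_n n). g x < \<infinity> \<and>
      herz_iter \<alpha> p q k g x \<le> 1 \<and>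
      ennreal (c ^ k) * herz_iter (\<lambda>i. - \<alpha> i) p' q' k F x \<le> nn_integral_iter k (\<lambda>x. F x * g x) x"
  using assms(5)
proof (induction k)
  case 0
  show ?case by (intro bexI[of _ "\<lambda>_. 1"]) auto
next
  case (Suc k)
  let ?P = "lborel_n n"
  let ?m = "Suc k"
  from Suc obtain g where g [measurable]: "g \<in> borel_measurable ?P"
    and g_fin: "\<And>x. x \<in> space ?P \<Longrightarrow> g x < \<infinity>"
    and g_norm: "\<And>x. x \<in> space ?P \<Longrightarrow> herz_iter \<alpha> p q k g x \<le> 1"
    and g_ext: "\<And>x. x \<in> space ?P \<Longrightarrow>
      ennreal (c ^ k) * herz_iter (\<lambda>i. - \<alpha> i) p' q' k F x \<le> nn_integral_iter k (\<lambda>x. F x * g x) x"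
    by auto
  have m: "?m \<in> {1..n}" using Suc.prems by simp
  define H where "H = herz_iter (\<lambda>i. - \<alpha> i) p' q' k F"
  have H: "H \<in> borel_measurable ?P"
    unfolding H_def using Suc.prems exponents_ge_1 F by (intro herz_iter_measurable) auto
  have H_fin: "H (x(?m := t)) < \<infinity>" if "x \<in> space ?P" for x t
    unfolding H_def using Suc.prems that m by (intro fin fun_upd_in_space_lborel_n) auto
  have H_norm: "herz_norm (- \<alpha> ?m) (p' ?m) (q' ?m) (\<lambda>t. H (x(?m := t))) < \<infinity>" if "x \<in> space ?P" for x
    using fin[OF Suc.prems that] by (simp add: H_def)
  obtain w where w [measurable]: "case_prod w \<in> borel_measurable (?P \<Otimes>\<^sub>M lborel)"
    and w_fin: "\<And>x t. x \<in> space ?P \<Longrightarrow> w x t < \<infinity>"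
    and w_norm: "\<And>x. x \<in> space ?P \<Longrightarrow> herz_norm (\<alpha> ?m) (p ?m) (q ?m) (w x) \<le> 1"
    and w_ext: "\<And>x. x \<in> space ?P \<Longrightarrow> ennreal c * herz_norm (- \<alpha> ?m) (p' ?m) (q' ?m) (\<lambda>t. H (x(?m := t)))
      \<le> (\<integral>\<^sup>+t. H (x(?m := t)) * w x t \<partial>lborel)"
    using herz_norm_near_extremal[OF conj_p[OF m] conj_q[OF m] c measurable_slice[OF H m] H_fin H_norm]
    by blast
  \<comment> \<open>The selected \<open>w x\<close> may depend on all coordinates of \<open>x\<close>, even those already integrated. Evaluating
    it at the point with these coordinates reset to \<open>0\<close> removes this dependence.\<close>
  define z where "z x = (\<lambda>i\<in>{1..n}. if i \<le> ?m then 0 else x i)" for x :: "nat \<Rightarrow> real"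
  have z_meas: "z \<in> ?P \<rightarrow>\<^sub>M ?P"
    unfolding z_def by (rule measurable_restrict) (auto split: if_splits)
  have z_space: "z x \<in> space ?P" for x by (auto simp: z_def space_PiM)
  have z_upd: "z (x(i := t)) = z x" if "i \<in> {1..?m}" for x i t
    using that by (auto simp: z_def fun_eq_iff restrict_def)
  have H_z: "H ((z x)(?m := t)) = H (x(?m := t))" if "x \<in> space ?P" for x t
    unfolding H_def using that Suc.prems
    by (intro herz_iter_depends) (auto simp: z_def space_PiM PiE_iff extensional_def)
  define u where "u x = w (z x) (x ?m)" for x
  have u [measurable]: "u \<in> borel_measurable ?P"
  proof -
    have [measurable]: "(\<lambda>x. x ?m) \<in> ?P \<rightarrow>\<^sub>M lborel" by (rule measurable_component_singleton[OF m])
    have "(\<lambda>x. case_prod w (z x, x ?m)) \<in> borel_measurable ?P"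
      by (rule measurable_compose[OF _ w]) (use z_meas in measurable)
    then show ?thesis by (simp add: u_def[abs_def])
  qed
  have u_fin: "u x < \<infinity>" for x unfolding u_def by (rule w_fin[OF z_space])
  have u_indep: "u (x(i := t)) = u x" if "i \<in> {1..k}" for x i t
    using that by (simp add: u_def z_upd)
  have u_upd: "u (x(?m := t)) = w (z x) t" for x t by (simp add: u_def z_upd)
  have w_z: "w (z x) \<in> borel_measurable borel" for x
    using measurable_compose[OF measurable_Pair1'[OF z_space] w] by simp
  have gu: "(\<lambda>x. g x * u x) \<in> borel_measurable ?P" by measurable
  show ?case
  proof (intro bexI[of _ "\<lambda>x. g x * u x"] ballI conjI)
    show "(\<lambda>x. g x * u x) \<in> borel_measurable ?P" by (rule gu)
  next
    fix x assume x: "x \<in> space ?P"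
    note upd = fun_upd_in_space_lborel_n[OF x m]
    show "g x * u x < \<infinity>" using g_fin[OF x] u_fin by (simp add: ennreal_mult_less_top)
    have "herz_iter \<alpha> p q k (\<lambda>x. g x * u x) (x(?m := t)) \<le> w (z x) t" for t
    proof -
      have "herz_iter \<alpha> p q k (\<lambda>x. g x * u x) (x(?m := t)) = herz_iter \<alpha> p q k g (x(?m := t)) * w (z x) t"
        using Suc.prems exponents_ge_1 u_indep u_fin upd g
        by (subst herz_iter_multc[where n = n]) (auto simp: u_upd)
      also have "\<dots> \<le> 1 * w (z x) t" by (intro mult_right_mono g_norm upd) auto
      finally show ?thesis by simp
    qed
    then have "herz_iter \<alpha> p q ?m (\<lambda>x. g x * u x) x \<le> herz_norm (\<alpha> ?m) (p ?m) (q ?m) (w (z x))"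
      using Suc.prems exponents_ge_1 m x w_z gu
      by (simp, intro herz_norm_mono herz_iter_slice_measurable) auto
    then show "herz_iter \<alpha> p q ?m (\<lambda>x. g x * u x) x \<le> 1"
      using w_norm[OF z_space] by (rule order.trans)
    have herz_eq: "herz_iter (\<lambda>i. - \<alpha> i) p' q' ?m F x
      = herz_norm (- \<alpha> ?m) (p' ?m) (q' ?m) (\<lambda>t. H (x(?m := t)))"
      by (simp add: H_def)
    have "ennreal (c ^ ?m) * herz_iter (\<lambda>i. - \<alpha> i) p' q' ?m F x
      = ennreal (c ^ k) * (ennreal c * herz_norm (- \<alpha> ?m) (p' ?m) (q' ?m) (\<lambda>t. H ((z x)(?m := t))))"
      unfolding herz_eq H_z[OF x] using c by (simp add: ennreal_mult ac_simps)
    also have "\<dots> \<le> ennreal (c ^ k) * (\<integral>\<^sup>+t. H ((z x)(?m := t)) * w (z x) t \<partial>lborel)"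
      by (intro mult_left_mono w_ext z_space) auto
    also have "\<dots> = ennreal (c ^ k) * (\<integral>\<^sup>+t. H (x(?m := t)) * w (z x) t \<partial>lborel)"
      by (simp add: H_z[OF x])
    also have "\<dots> = (\<integral>\<^sup>+t. ennreal (c ^ k) * (H (x(?m := t)) * w (z x) t) \<partial>lborel)"
      using measurable_slice_at[OF H m x] w_z by (subst nn_integral_cmult) auto
    also have "\<dots> \<le> (\<integral>\<^sup>+t. nn_integral_iter k (\<lambda>x. F x * (g x * u x)) (x(?m := t)) \<partial>lborel)"
    proof (rule nn_integral_mono)
      fix t
      have "ennreal (c ^ k) * (H (x(?m := t)) * w (z x) t) = (ennreal (c ^ k) * H (x(?m := t))) * w (z x) t"
        by (simp add: mult.assoc)
      also have "\<dots> \<le> nn_integral_iter k (\<lambda>x. F x * g x) (x(?m := t)) * u (x(?m := t))"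
        unfolding u_upd H_def by (intro mult_right_mono g_ext upd) auto
      also have "\<dots> = nn_integral_iter k (\<lambda>x. F x * g x * u x) (x(?m := t))"
        using Suc.prems F g u_indep upd by (subst nn_integral_iter_multc[where n = n]) auto
      finally show "ennreal (c ^ k) * (H (x(?m := t)) * w (z x) t)
        \<le> nn_integral_iter k (\<lambda>x. F x * (g x * u x)) (x(?m := t))" by (simp add: mult.assoc)
    qed
    finally show "ennreal (c ^ ?m) * herz_iter (\<lambda>i. - \<alpha> i) p' q' ?m F x
      \<le> nn_integral_iter ?m (\<lambda>x. F x * (g x * u x)) x" by simp
  qed
qed

text \<open>
  Truncating \<open>F\<close> in height and to a box makes all inner norms finite; by the Fatou property some
  truncation still has norm greater than \<open>a\<close>, and a function that almost norms this truncation does for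
  \<open>F\<close> as well, since the truncation lies below \<open>F\<close>.
\<close>
lemma mixed_herz_norming_function:
  assumes n: "1 \<le> n" and F [measurable]: "F \<in> borel_measurable (lborel_n n)"
    and a: "a < herz_iter (\<lambda>i. - \<alpha> i) p' q' n F x" and x: "x \<in> space (lborel_n n)"
  obtains g where "g \<in> borel_measurable (lborel_n n)" "\<And>x. x \<in> space (lborel_n n) \<Longrightarrow> g x < \<infinity>"
    "herz_iter \<alpha> p q n g x \<le> 1" "a < (\<integral>\<^sup>+x. F x * g x \<partial>lborel_n n)"
proof -
  let ?P = "lborel_n n"
  let ?N = "\<lambda>F. herz_iter (\<lambda>i. - \<alpha> i) p' q' n F x"
  define box :: "nat \<Rightarrow> (nat \<Rightarrow> real) \<Rightarrow> ennreal"
    where "box j = indicator {x. \<forall>i\<in>{1..n}. x i \<in> annulus j}" for j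
  define T where "T j x = min (F x) (of_nat j * box j x)" for j x
  have [measurable]: "box j \<in> borel_measurable ?P" for j
    unfolding box_def by (rule borel_measurable_indicator') measurable
  have T_meas [measurable]: "T j \<in> borel_measurable ?P" for j unfolding T_def by measurable
  have box_mono: "box i y \<le> box j y" if "i \<le> j" for i j y
    unfolding box_def using annulus_mono[OF that] by (auto split: split_indicator)
  have T_inc: "incseq (\<lambda>j. T j y)" for y
    by (auto simp: T_def incseq_def intro!: min.coboundedI2 mult_mono box_mono)
  have T_SUP: "(SUP j. T j y) = F y" for y
  proof (rule antisym)
    show "(SUP j. T j y) \<le> F y" unfolding T_def by (intro SUP_least) auto
    \<comment> \<open>From this index on, \<open>y\<close> lies in the box and only the height is cut off.\<close>
    define J where "J = Max (insert 0 ((\<lambda>i. nat \<bar>shell_index (y i)\<bar>) ` {1..n}))"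
    have J: "nat \<bar>shell_index (y i)\<bar> \<le> J" if "i \<in> {1..n}" for i
      unfolding J_def using that by (intro Max_ge) auto
    have "box j y = 1" if "J \<le> j" for j
    proof -
      have "y i \<in> annulus j" if "i \<in> {1..n}" for i
        using annulus_mono[of "nat \<bar>shell_index (y i)\<bar>" j] J[OF that] \<open>J \<le> j\<close> mem_annulus_nat[of "y i"]
        by auto
      then show ?thesis by (simp add: box_def)
    qed
    then have T_eq: "T j y = min (F y) (of_nat j)" if "J \<le> j" for j using that by (simp add: T_def)
    show "F y \<le> (SUP j. T j y)"
    proof (rule dense_le)
      fix b assume b: "b < F y"
      then have "b < top" by (auto intro: less_le_trans)
      then obtain i where i: "b < of_nat i" using ennreal_Ex_less_of_nat by auto
      have "b \<le> T (max i J) y" using b i by (auto simp: T_eq intro: order.trans[OF less_imp_le])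
      then show "b \<le> (SUP j. T j y)" by (rule SUP_upper2[rotated]) simp
    qed
  qed
  have "?N F = (SUP j. ?N (T j))"
    using herz_iter_SUP[of n p' q' T n x "\<lambda>i. - \<alpha> i"] exponents_ge_1 T_meas T_inc x by (simp add: T_SUP)
  with a obtain j where j: "a < ?N (T j)" by (auto simp: less_SUP_iff)
  have fin: "herz_iter (\<lambda>i. - \<alpha> i) p' q' k (T j) y < \<infinity>" if "k \<le> n" "y \<in> space ?P" for k y
    using herz_iter_finite[of n p' q' "T j" "of_nat j" j k "\<lambda>i. - \<alpha> i"] exponents_ge_1 that T_meas
    by (auto simp: T_def box_def of_nat_less_top)
  obtain a' N' where a': "0 \<le> a'" "a = ennreal a'" and N': "0 \<le> N'" "?N (T j) = ennreal N'" and "a' < N'"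
    using j fin[OF order.refl x] by (cases a; cases "?N (T j)") (auto simp: ennreal_less_iff)
  define d where "d = (a' + N') / (2 * N')"
  have d: "0 < d" "d < 1" "a' < d * N'" using a' \<open>a' < N'\<close> by (auto simp: d_def field_simps)
  \<comment> \<open>Each of the \<open>n\<close> coordinates costs a factor \<open>c\<close>, and \<open>d\<close> is still affordable.\<close>
  define c where "c = root n d"
  have c: "0 < c" "c < 1" "c ^ n = d" using d n by (auto simp: c_def)
  obtain g where g [measurable]: "g \<in> borel_measurable ?P" and g_fin: "\<And>y. y \<in> space ?P \<Longrightarrow> g y < \<infinity>"
    and g_norm: "\<And>y. y \<in> space ?P \<Longrightarrow> herz_iter \<alpha> p q n g y \<le> 1"
    and g_ext: "\<And>y. y \<in> space ?P \<Longrightarrow>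
      ennreal (c ^ n) * herz_iter (\<lambda>i. - \<alpha> i) p' q' n (T j) y \<le> nn_integral_iter n (\<lambda>y. T j y * g y) y"
    using herz_iter_near_extremal[OF c(1,2) T_meas fin order.refl] by blast
  have "a < ennreal (c ^ n) * ?N (T j)"
    using a' N' c d by (simp add: ennreal_less_iff flip: ennreal_mult)
  also have "\<dots> \<le> nn_integral_iter n (\<lambda>y. T j y * g y) x" by (rule g_ext[OF x])
  also have "\<dots> = (\<integral>\<^sup>+y. T j y * g y \<partial>?P)"
    unfolding nn_integral_iter_base_point[OF x, symmetric]
    by (rule nn_integral_lborel_n[symmetric]) measurable
  also have "\<dots> \<le> (\<integral>\<^sup>+y. F y * g y \<partial>?P)"
    by (intro nn_integral_mono mult_right_mono) (auto simp: T_def)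
  finally show ?thesis using that[OF g g_fin g_norm[OF x]] by blast
qed

end

section \<open>The associate space\<close>

lemma space_lborel_n_nonempty: obtains x where "x \<in> space (lborel_n n)"
proof
  show "(\<lambda>i\<in>{1..n}. 0) \<in> space (lborel_n n)" by (simp add: space_PiM)
qed

text \<open>
  Only the modulus enters the norms, and a modulus measurable for the completion agrees almost everywhere
  with a Borel function. The sections of the latter are all measurable.
\<close>
lemma norm_borel_version:
  fixes f :: "(nat \<Rightarrow> real) \<Rightarrow> 'a::real_normed_field"
  assumes "f \<in> borel_measurable (lebesgue_n n)"
  obtains F where "F \<in> borel_measurable (lborel_n n)" "AE x in lborel_n n. ennreal (norm (f x)) = F x"
proof -
  have "(\<lambda>x. ennreal (norm (f x))) \<in> borel_measurable (completion (lborel_n n))"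
    using assms unfolding lebesgue_n_def by measurable
  from completion_ex_borel_measurable[OF this] show ?thesis using that by auto
qed

lemma nn_integral_lebesgue_n_norm_mult:
  fixes f g :: "(nat \<Rightarrow> real) \<Rightarrow> 'a::real_normed_field"
  assumes "AE x in lborel_n n. ennreal (norm (f x)) = F x" "AE x in lborel_n n. ennreal (norm (g x)) = G x"
  shows "(\<integral>\<^sup>+x. ennreal (norm (f x * g x)) \<partial>lebesgue_n n) = (\<integral>\<^sup>+x. F x * G x \<partial>lborel_n n)"
proof -
  have "(\<integral>\<^sup>+x. ennreal (norm (f x * g x)) \<partial>lebesgue_n n)
    = (\<integral>\<^sup>+x. ennreal (norm (f x * g x)) \<partial>lborel_n n)"
    unfolding lebesgue_n_def by (rule nn_integral_completion)
  also have "\<dots> = (\<integral>\<^sup>+x. F x * G x \<partial>lborel_n n)"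
    using assms by (intro nn_integral_cong_AE, eventually_elim) (simp add: norm_mult ennreal_mult)
  finally show ?thesis .
qed

theorem corollary2p19:
  fixes n :: nat and \<alpha> :: "nat \<Rightarrow> real" and p q p' q' :: "nat \<Rightarrow> ennreal"
    and f :: "(nat \<Rightarrow> real) \<Rightarrow> 'a::real_normed_field"
  assumes "n \<ge> 1"
    and "\<forall>i\<in>{1..n}. 1 \<le> p i \<and> 1 \<le> q i"
    and "\<forall>i\<in>{1..n}. 1 / p i + 1 / p' i = 1 \<and> 1 / q i + 1 / q' i = 1"
    and "f \<in> borel_measurable (lebesgue_n n)"
  shows "(f \<in> assoc_space n \<alpha> p q \<longleftrightarrow> f \<in> mixed_herz_space n (\<lambda>i. - \<alpha> i) p' q') \<and>
    assoc_norm n \<alpha> p q f = mixed_herz_norm n (\<lambda>i. - \<alpha> i) p' q' f"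
proof -
  let ?P = "lborel_n n"
  let ?X = "mixed_herz_norm n (\<lambda>i. - \<alpha> i) p' q' f"
  have conj: "\<And>i. i \<in> {1..n} \<Longrightarrow> conjugate_exponents (p i) (p' i)"
    "\<And>i. i \<in> {1..n} \<Longrightarrow> conjugate_exponents (q i) (q' i)"
    using assms(2,3) by (auto simp: conjugate_exponents_def)
  have ge1: "1 \<le> p i" "1 \<le> q i" "1 \<le> p' i" "1 \<le> q' i" if "i \<in> {1..n}" for i
    using conj[OF that] by (simp_all add: conjugate_exponents_ge_1)
  obtain z where z: "z \<in> space ?P" by (rule space_lborel_n_nonempty)
  obtain F where F: "F \<in> borel_measurable ?P" and fF: "AE x in ?P. ennreal (norm (f x)) = F x"
    by (rule norm_borel_version[OF assms(4)])
  have X: "?X = herz_iter (\<lambda>i. - \<alpha> i) p' q' n F z"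
    unfolding mixed_herz_norm_def using ge1 fF
    by (subst herz_iter_full_cong_AE[where G = F]) (auto simp: herz_iter_base_point[OF z])
  have Hoelder: "nn_integral_iter n (\<lambda>x. F x * G x) z \<le> ?X * herz_iter \<alpha> p q n G z"
    if "G \<in> borel_measurable ?P" for G
    unfolding X using conj F that z by (intro herz_iter_Hoelder) auto
  have integral_iter: "(\<integral>\<^sup>+x. F x * G x \<partial>?P) = nn_integral_iter n (\<lambda>x. F x * G x) z"
    if "G \<in> borel_measurable ?P" for G
  proof -
    note [measurable] = F that
    show ?thesis
      unfolding nn_integral_iter_base_point[OF z, symmetric] by (rule nn_integral_lborel_n) measurable
  qed
  have eq: "assoc_norm n \<alpha> p q f = ?X"
  proof (rule antisym)
    show "assoc_norm n \<alpha> p q f \<le> ?X"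
      unfolding assoc_norm_def
    proof (rule SUP_least)
      fix g :: "(nat \<Rightarrow> real) \<Rightarrow> 'a"
      assume "g \<in> {g \<in> mixed_herz_space n \<alpha> p q. mixed_herz_norm n \<alpha> p q g = 1}"
      then have g: "g \<in> borel_measurable (lebesgue_n n)" and g1: "mixed_herz_norm n \<alpha> p q g = 1"
        by (auto simp: mixed_herz_space_def)
      obtain G where G: "G \<in> borel_measurable ?P" and gG: "AE x in ?P. ennreal (norm (g x)) = G x"
        by (rule norm_borel_version[OF g])
      have "herz_iter \<alpha> p q n G z = 1"
        using g1 ge1 gG unfolding mixed_herz_norm_def
        by (subst (asm) herz_iter_full_cong_AE[where G = G]) (auto simp: herz_iter_base_point[OF z])
      then show "(\<integral>\<^sup>+x. ennreal (norm (f x * g x)) \<partial>lebesgue_n n) \<le> ?X"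
        using Hoelder[OF G] by (simp add: nn_integral_lebesgue_n_norm_mult[OF fF gG] integral_iter[OF G] del: One_nat_def)
    qed
    show "?X \<le> assoc_norm n \<alpha> p q f"
    proof (rule dense_le)
      fix a assume "a < ?X"
      then have a: "a < herz_iter (\<lambda>i. - \<alpha> i) p' q' n F z" by (simp add: X)
      obtain h where h [measurable]: "h \<in> borel_measurable ?P"
        and h_fin: "\<And>x. x \<in> space ?P \<Longrightarrow> h x < \<infinity>"
        and h_norm: "herz_iter \<alpha> p q n h z \<le> 1" and h_int: "a < (\<integral>\<^sup>+x. F x * h x \<partial>?P)"
        by (rule mixed_herz_norming_function[where p = p and p' = p' and q = q and q' = q' and \<alpha> = \<alpha>,
              OF _ _ assms(1) F a z]) (use conj in blast)+
      have "herz_iter \<alpha> p q n h z \<noteq> 0"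
        using Hoelder[OF h] h_int by (auto simp: integral_iter[OF h] simp del: One_nat_def)
      then obtain s where s: "0 < s" "s \<le> 1" "herz_iter \<alpha> p q n h z = ennreal s"
        using h_norm by (cases "herz_iter \<alpha> p q n h z") (auto simp: less_le top_unique)
      \<comment> \<open>Normalising \<open>h\<close>, whose norm is at most \<open>1\<close>, can only increase the integral.\<close>
      define g :: "(nat \<Rightarrow> real) \<Rightarrow> 'a" where "g x = of_real (enn2real (h x) / s)" for x
      have g_meas: "g \<in> borel_measurable (lebesgue_n n)"
        unfolding lebesgue_n_def g_def by (rule measurable_completion) measurable
      have g_eq: "ennreal (norm (g x)) = h x * ennreal (1 / s)" if "x \<in> space ?P" for x
        using h_fin[OF that] s by (cases "h x") (auto simp: g_def norm_divide simp flip: ennreal_mult)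
      have "mixed_herz_norm n \<alpha> p q g = herz_iter \<alpha> p q n (\<lambda>x. h x * ennreal (1 / s)) z"
        unfolding mixed_herz_norm_def herz_iter_base_point[OF z]
        by (rule herz_iter_cong[OF order.refl g_eq z])
      also have "\<dots> = herz_iter \<alpha> p q n h z * ennreal (1 / s)"
        using ge1 h z by (intro herz_iter_multc[where n = n]) auto
      also have "\<dots> = 1" using s by (simp flip: ennreal_mult)
      finally have "mixed_herz_norm n \<alpha> p q g = 1" .
      then have mem: "g \<in> {g \<in> mixed_herz_space n \<alpha> p q. mixed_herz_norm n \<alpha> p q g = 1}"
        using g_meas by (simp add: mixed_herz_space_def)
      have "a \<le> (\<integral>\<^sup>+x. F x * h x \<partial>?P)" using h_int by simp
      also have "\<dots> \<le> (\<integral>\<^sup>+x. F x * (h x * ennreal (1 / s)) \<partial>?P)"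
      proof (intro nn_integral_mono mult_left_mono)
        fix x
        have "h x * 1 \<le> h x * ennreal (1 / s)"
          using s by (intro mult_left_mono) (simp_all flip: ennreal_1 add: ennreal_leI)
        then show "h x \<le> h x * ennreal (1 / s)" by simp
      qed simp
      also have "\<dots> = (\<integral>\<^sup>+x. ennreal (norm (f x * g x)) \<partial>lebesgue_n n)"
        using g_eq by (intro nn_integral_lebesgue_n_norm_mult[symmetric] fF AE_I2)
      also have "\<dots> \<le> assoc_norm n \<alpha> p q f"
        unfolding assoc_norm_def by (rule SUP_upper[OF mem])
      finally show "a \<le> assoc_norm n \<alpha> p q f" .
    qed
  qed
  then show ?thesis by (simp add: assoc_space_def mixed_herz_space_def)
qed

end
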